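(* Let $\kappa\in\mathbb{R}$, $a,b\in\mathbb{R}$, and let $n$ be a non-zero rational number. Consider the Hamiltonian system with two degrees of freedom given by $$H=\frac12\left(p_r^2+\frac{p_\varphi^2}{\mathrm{S}_\kappa(r)^2}\right)+\frac{1}{\mathrm{S}_\kappa(r)^2}\,U(\varphi),\qquad U(\varphi)=\frac{a}{\cos^2(n\varphi)}+\frac{b}{\sin^2(n\varphi)},$$ and let $G=\frac12p_\varphi^2+U(\varphi)$, which is a first integral commuting with $H$. Then the system is maximally super-integrable: besides $H$ and $G$ there is a further first integral, which can be chosen polynomial in the momenta $(p_r,p_\varphi)$, such that the three are functionally independent. Moreover, if $n$ is a positive integer, then the following two functions, polynomial in $(p_r,p_\varphi)$, are first integrals: $$I_1=\sum_{j=0}^{n}(-1)^j\binom{2n}{2j}(2G)^{n-j}\left(\frac{\mathrm{C}_\kappa(r)}{\mathrm{S}_\kappa(r)}\right)^{2n-2j-1}p_r^{2j}\left[G\,p_\varphi\sin(2n\varphi)\frac{\mathrm{C}_\kappa(r)}{\mathrm{S}_\kappa(r)}-\frac{2(n-j)}{2j+1}\,p_r\bigl(G\cos(2n\varphi)+b-a\bigr)\right],$$ $$I_2=\sum_{j=0}^{n}(-1)^j\binom{2n}{2j}(2G)^{n-j}\left(\frac{\mathrm{C}_\kappa(r)}{\mathrm{S}_\kappa(r)}\right)^{2n-2j-1}p_r^{2j}\left[\frac{\mathrm{C}_\kappa(r)}{\mathrm{S}_\kappa(r)}\bigl(G\cos(2n\varphi)+b-a\bigr)+\frac{n-j}{2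j+1}\,p_rp_\varphi\sin(2n\varphi)\right].$$
   Context: For $\kappa\in\mathbb{R}$: $\mathrm{C}_\kappa(x)=\cos(\sqrt{\kappa}\,x)$ and $\mathrm{S}_\kappa(x)=\frac{1}{\sqrt{\kappa}}\sin(\sqrt{\kappa}\,x)$ if $\kappa>0$; $\mathrm{C}_0(x)=1$ and $\mathrm{S}_0(x)=x$; $\mathrm{C}_\kappa(x)=\cosh(\sqrt{-\kappa}\,x)$ and $\mathrm{S}_\kappa(x)=\frac{1}{\sqrt{-\kappa}}\sinh(\sqrt{-\kappa}\,x)$ if $\kappa<0$. They satisfy $\mathrm{C}_\kappa^2+\kappa\,\mathrm{S}_\kappa^2=1$, $\mathrm{S}_\kappa'=\mathrm{C}_\kappa$, $\mathrm{C}_\kappa'=-\kappa\,\mathrm{S}_\kappa$. The phase space is the set of $(r,\varphi,p_r,p_\varphi)\in\mathbb{R}^4$ with $\mathrm{S}_\kappa(r)\neq0$ and $\sin(n\varphi)\cos(n\varphi)\neq0$ (here $\varphi$ is a real coordinate, not taken modulo $2\pi$), with canonical coordinates $(r,\varphi)$ and conjugate momenta $(p_r,p_\varphi)$. A first integral is a real-analytic function on the phase space whose Poisson bracket with $H$ vanishes. Functionally independent means that the differentials are linearly independent on a dense open subset. A function is polynomial in the momenta if it is a polynomial in $(p_r,p_\varphi)$ with coefficients that are functions of $(r,\varphi)$. A system with two degrees of freedom is maximally super-integrable if it has three functionally independent first integrals, two of which Poisson commute. In the formulas for $I_1,I_2$ the factor $(\mathrm{C}_\kappa/\mathrm{S}_\kappa)^{2n-2j-1}$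 is understood to be multiplied into the bracket, so that in the term $j=n$ no negative power occurs (the second summand in the bracket vanishes there and the first one has a factor $\mathrm{C}_\kappa/\mathrm{S}_\kappa$). *)

theory Defs
  imports "HOL-Analysis.Analysis"
begin

definition C_kappa :: "real \<Rightarrow> real \<Rightarrow> real" where
  "C_kappa \<kappa> x =
     (if \<kappa> > 0 then cos (sqrt \<kappa> * x)
      else if \<kappa> = 0 then 1
      else cosh (sqrt (- \<kappa>) * x))"

definition S_kappa :: "real \<Rightarrow> real \<Rightarrow> real" where
  "S_kappa \<kappa> x =
     (if \<kappa> > 0 then sin (sqrt \<kappa> * x) / sqrt \<kappa>
      else if \<kappa> = 0 then x
      else sinh (sqrt (- \<kappa>) * x) / sqrt (- \<kappa>))"

(* Points are (r, phi, p_r, p_phi); all functions below are considered on the phase space only. *)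
type_synonym point = "real \<times> real \<times> real \<times> real"

definition phase_space :: "real \<Rightarrow> real \<Rightarrow> point set" where
  "phase_space \<kappa> n =
     {(r, \<phi>, p\<^sub>r, p\<^sub>\<phi>). S_kappa \<kappa> r \<noteq> 0 \<and> sin (n * \<phi>) * cos (n * \<phi>) \<noteq> 0}"

(* Near each point, f is the sum of a power series in the four coordinate increments
   (unordered, hence absolutely convergent, summation over all multi-indices).
   Meant for open M. *)
definition real_analytic_on :: "(point \<Rightarrow> real) \<Rightarrow> point set \<Rightarrow> bool" where
  "real_analytic_on f M \<longleftrightarrow>
     (\<forall>(x\<^sub>1, x\<^sub>2, x\<^sub>3, x\<^sub>4) \<in> M. \<exists>\<epsilon>>0. \<exists>c :: nat \<times> nat \<times> nat \<times> nat \<Rightarrow> real.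
        \<forall>(y\<^sub>1, y\<^sub>2, y\<^sub>3, y\<^sub>4) \<in> ball (x\<^sub>1, x\<^sub>2, x\<^sub>3, x\<^sub>4) \<epsilon>.
          ((\<lambda>(i, j, k, l). c (i, j, k, l) *
              (y\<^sub>1 - x\<^sub>1) ^ i * (y\<^sub>2 - x\<^sub>2) ^ j * (y\<^sub>3 - x\<^sub>3) ^ k * (y\<^sub>4 - x\<^sub>4) ^ l)
            has_sum f (y\<^sub>1, y\<^sub>2, y\<^sub>3, y\<^sub>4)) UNIV)"

definition poisson :: "(point \<Rightarrow> real) \<Rightarrow> (point \<Rightarrow> real) \<Rightarrow> point \<Rightarrow> real" where
  "poisson f g x =
     (let df = frechet_derivative f (at x); dg = frechet_derivative g (at x);
          e_r = (1, 0, 0, 0); e_\<phi> = (0, 1, 0, 0); e_p\<^sub>r = (0, 0, 1, 0); e_p\<^sub>\<phi> = (0, 0, 0, 1)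
      in df e_r * dg e_p\<^sub>r - df e_p\<^sub>r * dg e_r + df e_\<phi> * dg e_p\<^sub>\<phi> - df e_p\<^sub>\<phi> * dg e_\<phi>)"

definition poisson_commute :: "point set \<Rightarrow> (point \<Rightarrow> real) \<Rightarrow> (point \<Rightarrow> real) \<Rightarrow> bool" where
  "poisson_commute M f g \<longleftrightarrow> (\<forall>x\<in>M. poisson f g x = 0)"

definition first_integral :: "point set \<Rightarrow> (point \<Rightarrow> real) \<Rightarrow> (point \<Rightarrow> real) \<Rightarrow> bool" where
  "first_integral M H F \<longleftrightarrow> real_analytic_on F M \<and> poisson_commute M F H"

definition functionally_independent :: "point set \<Rightarrow> (point \<Rightarrow> real) list \<Rightarrow> bool" where
  "functionally_independent M Fs \<longleftrightarrow>
     (\<exists>D. open D \<and> D \<subseteq> M \<and> M \<subseteq> closure D \<and>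
        (\<forall>x\<in>D. \<forall>c :: nat \<Rightarrow> real.
           (\<forall>v. (\<Sum>i<length Fs. c i * frechet_derivative (Fs ! i) (at x) v) = 0) \<longrightarrow>
           (\<forall>i<length Fs. c i = 0)))"

definition polynomial_in_momenta :: "point set \<Rightarrow> (point \<Rightarrow> real) \<Rightarrow> bool" where
  "polynomial_in_momenta M F \<longleftrightarrow>
     (\<exists>N. \<exists>c :: nat \<Rightarrow> nat \<Rightarrow> real \<Rightarrow> real \<Rightarrow> real.
        \<forall>(r, \<phi>, p\<^sub>r, p\<^sub>\<phi>) \<in> M.
          F (r, \<phi>, p\<^sub>r, p\<^sub>\<phi>) = (\<Sum>i\<le>N. \<Sum>j\<le>N. c i j r \<phi> * p\<^sub>r ^ i * p\<^sub>\<phi> ^ j))"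

definition maximally_superintegrable :: "point set \<Rightarrow> (point \<Rightarrow> real) \<Rightarrow> bool" where
  "maximally_superintegrable M H \<longleftrightarrow>
     (\<exists>F\<^sub>1 F\<^sub>2 F\<^sub>3. first_integral M H F\<^sub>1 \<and> first_integral M H F\<^sub>2 \<and> first_integral M H F\<^sub>3 \<and>
        functionally_independent M [F\<^sub>1, F\<^sub>2, F\<^sub>3] \<and> poisson_commute M F\<^sub>1 F\<^sub>2)"

definition potential :: "real \<Rightarrow> real \<Rightarrow> real \<Rightarrow> real \<Rightarrow> real" where
  "potential a b n \<phi> = a / (cos (n * \<phi>))\<^sup>2 + b / (sin (n * \<phi>))\<^sup>2"

definition hamiltonian :: "real \<Rightarrow> real \<Rightarrow> real \<Rightarrow> real \<Rightarrow> point \<Rightarrow> real" where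
  "hamiltonian \<kappa> a b n = (\<lambda>(r, \<phi>, p\<^sub>r, p\<^sub>\<phi>).
     1 / 2 * (p\<^sub>r\<^sup>2 + p\<^sub>\<phi>\<^sup>2 / (S_kappa \<kappa> r)\<^sup>2) + 1 / (S_kappa \<kappa> r)\<^sup>2 * potential a b n \<phi>)"

definition angular_integral :: "real \<Rightarrow> real \<Rightarrow> real \<Rightarrow> point \<Rightarrow> real" where
  "angular_integral a b n = (\<lambda>(r, \<phi>, p\<^sub>r, p\<^sub>\<phi>). 1 / 2 * p\<^sub>\<phi>\<^sup>2 + potential a b n \<phi>)"

(* In I_1 and I_2 the factor (C/S)^(2n-2j-1) is multiplied into the bracket. For j = n the
   truncated exponent 2*n - 2*j - 1 is harmless, as its term has the factor real (n - j) = 0. *)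
definition I_1 :: "real \<Rightarrow> real \<Rightarrow> real \<Rightarrow> nat \<Rightarrow> point \<Rightarrow> real" where
  "I_1 \<kappa> a b n = (\<lambda>(r, \<phi>, p\<^sub>r, p\<^sub>\<phi>).
     let G = angular_integral a b (real n) (r, \<phi>, p\<^sub>r, p\<^sub>\<phi>);
         T = C_kappa \<kappa> r / S_kappa \<kappa> r
     in \<Sum>j=0..n. (-1) ^ j * real ((2 * n) choose (2 * j)) * (2 * G) ^ (n - j) * p\<^sub>r ^ (2 * j) *
          (T ^ (2 * n - 2 * j) * (G * p\<^sub>\<phi> * sin (2 * real n * \<phi>))
           - T ^ (2 * n - 2 * j - 1) *
             (2 * real (n - j) / real (2 * j + 1) * p\<^sub>r * (G * cos (2 * real n * \<phi>) + b - a))))"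

definition I_2 :: "real \<Rightarrow> real \<Rightarrow> real \<Rightarrow> nat \<Rightarrow> point \<Rightarrow> real" where
  "I_2 \<kappa> a b n = (\<lambda>(r, \<phi>, p\<^sub>r, p\<^sub>\<phi>).
     let G = angular_integral a b (real n) (r, \<phi>, p\<^sub>r, p\<^sub>\<phi>);
         T = C_kappa \<kappa> r / S_kappa \<kappa> r
     in \<Sum>j=0..n. (-1) ^ j * real ((2 * n) choose (2 * j)) * (2 * G) ^ (n - j) * p\<^sub>r ^ (2 * j) *
          (T ^ (2 * n - 2 * j) * (G * cos (2 * real n * \<phi>) + b - a)
           + T ^ (2 * n - 2 * j - 1) *
             (real (n - j) / real (2 * j + 1) * p\<^sub>r * p\<^sub>\<phi> * sin (2 * real n * \<phi>))))"

end

theory Submission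
  imports Defs "HOL-Complex_Analysis.Cauchy_Integral_Formula"
begin

text \<open>
  In the time \<open>\<tau>\<close> with \<open>dt = S\<^sup>2 d\<tau>\<close> the equations of motion decouple. With a formal root \<open>s\<close> of
  \<open>- 2 G\<close>, the radial quantity \<open>p_r - s C/S\<close> and the angular quantity
  \<open>w = G cos (2 n \<phi>) + b - a + s (p_\<phi> sin (2 n \<phi>) / 2)\<close> rotate uniformly, their frequencies being in
  the ratio \<open>1 : 2 n\<close>. For \<open>n = m / l\<close> the product of the \<open>(2 m)\<close>-th power of the former with the
  \<open>l\<close>-th power of the conjugate of \<open>w\<close> is therefore constant, and so are its two components, which
  are polynomial in \<open>G\<close> and in the momenta. For \<open>l = 1\<close> they are \<open>I_1\<close> (up to the factor \<open>2 G\<close>)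
  and \<open>I_2\<close>, up to sign. Along the flow of \<open>G\<close>, on the other hand, the components rotate into one
  another with frequency \<open>2 m\<close>, so the second component \<open>F\<close> is independent of \<open>H\<close> and \<open>G\<close> wherever
  the first one does not vanish. The first cannot vanish on an open set: then its bracket with \<open>G\<close>,
  hence also \<open>F\<close>, would vanish there, contradicting
  \<open>\<bar>w\<bar>\<^sup>2 = (G - a - b)\<^sup>2 - 4 a b\<close> and \<open>\<bar>p_r - s C/S\<bar>\<^sup>2 = p_r\<^sup>2 + 2 G (C/S)\<^sup>2\<close>.
\<close>

section \<open>Functions with a holomorphic extension\<close>

text \<open>Analyticity in one real variable is encoded by a complex extension: closure under sums,
  products and reciprocals is then that of holomorphic functions, and the Taylor series converges on
  a whole disc.\<close>

definition holomorphic_extension_at :: "(real \<Rightarrow> real) \<Rightarrow> real \<Rightarrow> bool" where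
  "holomorphic_extension_at f x \<longleftrightarrow>
     (\<exists>F. \<exists>e>0. F holomorphic_on ball (of_real x) e \<and>
        (\<forall>t. dist x t < e \<longrightarrow> F (of_real t) = of_real (f t)))"

lemma holomorphic_extension_at_entire:
  assumes "F holomorphic_on UNIV" and "\<And>t. F (of_real t) = of_real (f t)"
  shows "holomorphic_extension_at f x"
  unfolding holomorphic_extension_at_def
  using assms by (intro exI[of _ F] exI[of _ 1]) (auto intro: holomorphic_on_subset)

lemma holomorphic_extension_at_const: "holomorphic_extension_at (\<lambda>t. c) x"
  by (rule holomorphic_extension_at_entire[of "\<lambda>z. of_real c"]) auto

lemma holomorphic_extension_at_id: "holomorphic_extension_at (\<lambda>t. t) x"
  by (rule holomorphic_extension_at_entire[of "\<lambda>z. z"]) auto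

lemma holomorphic_extension_at_add:
  assumes "holomorphic_extension_at f x" "holomorphic_extension_at g x"
  shows "holomorphic_extension_at (\<lambda>t. f t + g t) x"
proof -
  obtain F d where F: "d > 0" "F holomorphic_on ball (of_real x) d"
      "\<And>t. dist x t < d \<Longrightarrow> F (of_real t) = of_real (f t)"
    using assms(1) unfolding holomorphic_extension_at_def by blast
  obtain G e where G: "e > 0" "G holomorphic_on ball (of_real x) e"
      "\<And>t. dist x t < e \<Longrightarrow> G (of_real t) = of_real (g t)"
    using assms(2) unfolding holomorphic_extension_at_def by blast
  have "(\<lambda>z. F z + G z) holomorphic_on ball (of_real x) (min d e)"
    by (intro holomorphic_intros holomorphic_on_subset[OF F(2)] holomorphic_on_subset[OF G(2)]) auto
  then show ?thesis
    unfolding holomorphic_extension_at_def using F G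
    by (intro exI[of _ "\<lambda>z. F z + G z"] exI[of _ "min d e"]) auto
qed

lemma holomorphic_extension_at_mult:
  assumes "holomorphic_extension_at f x" "holomorphic_extension_at g x"
  shows "holomorphic_extension_at (\<lambda>t. f t * g t) x"
proof -
  obtain F d where F: "d > 0" "F holomorphic_on ball (of_real x) d"
      "\<And>t. dist x t < d \<Longrightarrow> F (of_real t) = of_real (f t)"
    using assms(1) unfolding holomorphic_extension_at_def by blast
  obtain G e where G: "e > 0" "G holomorphic_on ball (of_real x) e"
      "\<And>t. dist x t < e \<Longrightarrow> G (of_real t) = of_real (g t)"
    using assms(2) unfolding holomorphic_extension_at_def by blast
  have "(\<lambda>z. F z * G z) holomorphic_on ball (of_real x) (min d e)"
    by (intro holomorphic_intros holomorphic_on_subset[OF F(2)] holomorphic_on_subset[OF G(2)]) auto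
  then show ?thesis
    unfolding holomorphic_extension_at_def using F G
    by (intro exI[of _ "\<lambda>z. F z * G z"] exI[of _ "min d e"]) auto
qed

lemma holomorphic_extension_at_power:
  "holomorphic_extension_at f x \<Longrightarrow> holomorphic_extension_at (\<lambda>t. f t ^ k) x"
  by (induction k) (auto intro: holomorphic_extension_at_const holomorphic_extension_at_mult)

text \<open>By continuity the extension stays away from zero on a smaller disc, where its reciprocal
  is holomorphic.\<close>

lemma holomorphic_extension_at_inverse:
  assumes "holomorphic_extension_at f x" and "f x \<noteq> 0"
  shows "holomorphic_extension_at (\<lambda>t. inverse (f t)) x"
proof -
  obtain F d where F: "d > 0" "F holomorphic_on ball (of_real x) d"
      "\<And>t. dist x t < d \<Longrightarrow> F (of_real t) = of_real (f t)"
    using assms(1) unfolding holomorphic_extension_at_def by blast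
  have "continuous_on (ball (of_real x) d) F"
    using F(2) holomorphic_on_imp_continuous_on by blast
  moreover have "F (of_real x) \<noteq> 0" using F assms(2) by auto
  ultimately obtain e where e: "e > 0" "\<And>z. dist (of_real x) z < e \<Longrightarrow> z \<in> ball (of_real x) d \<Longrightarrow> F z \<noteq> 0"
    using continuous_on_avoid[of "ball (of_real x) d" F "of_real x" 0] F(1) by (metis centre_in_ball)
  have "(\<lambda>z. inverse (F z)) holomorphic_on ball (of_real x) (min d e)"
    using e by (intro holomorphic_intros holomorphic_on_subset[OF F(2)]) auto
  then show ?thesis
    unfolding holomorphic_extension_at_def using F e
    by (intro exI[of _ "\<lambda>z. inverse (F z)"] exI[of _ "min d e"]) auto
qed

section \<open>Taylor expansion in one variable and products of unordered sums\<close>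

lemma holomorphic_extension_at_has_sum:
  assumes "holomorphic_extension_at f x"
  shows "\<exists>e>0. \<exists>a. \<forall>t. \<bar>t - x\<bar> < e \<longrightarrow> ((\<lambda>i::nat. a i * (t - x) ^ i) has_sum f t) UNIV"
proof -
  obtain F e where F: "e > 0" "F holomorphic_on ball (of_real x) e"
      "\<And>t. dist x t < e \<Longrightarrow> F (of_real t) = of_real (f t)"
    using assms unfolding holomorphic_extension_at_def by blast
  define c where "c i = (deriv ^^ i) F (of_real x) / fact i" for i
  have sums: "(\<lambda>i. c i * (w - of_real x) ^ i) sums F w" if "w \<in> ball (of_real x) e" for w
    unfolding c_def using holomorphic_power_series[OF F(2) that] .
  have "((\<lambda>i. Re (c i) * (t - x) ^ i) has_sum f t) UNIV" if t: "\<bar>t - x\<bar> < e" for t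
  proof -
    \<comment> \<open>Convergence at a radius strictly beyond \<open>t\<close> gives absolute
      convergence at \<open>t\<close>, as an unordered sum demands.\<close>
    obtain s where s: "\<bar>t - x\<bar> < s" "s < e" using t dense by blast
    have "summable (\<lambda>i. c i * (of_real s) ^ i)"
      using sums[of "of_real x + of_real s"] s by (auto simp: dist_norm sums_iff)
    then have "summable (\<lambda>i. norm (c i * (of_real (t - x)) ^ i))"
      by (rule powser_insidea) (use s in \<open>simp add: norm_of_real del: of_real_diff\<close>)
    moreover have "(\<lambda>i. c i * (of_real (t - x)) ^ i) sums F (of_real t)"
      using sums[of "of_real t"] t by (simp add: dist_commute dist_real_def)
    ultimately have "((\<lambda>i. c i * (of_real (t - x)) ^ i) has_sum F (of_real t)) UNIV"
      by (rule norm_summable_imp_has_sum)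
    then have "((\<lambda>i. Re (c i * (of_real (t - x)) ^ i)) has_sum Re (F (of_real t))) UNIV"
      by (rule has_sum_Re)
    moreover have "F (of_real t) = of_real (f t)"
      using F(3) t by (simp add: dist_commute dist_real_def)
    moreover have "Re (c i * (of_real (t - x)) ^ i) = Re (c i) * (t - x) ^ i" for i
      unfolding of_real_power[symmetric] by simp
    ultimately show ?thesis by simp
  qed
  then show ?thesis
    by (intro exI[of _ e] conjI F(1) exI[of _ "\<lambda>i. Re (c i)"]) simp
qed

text \<open>Summable real families are absolutely summable, so the product family is too, and its
  sum can be taken iteratively.\<close>

lemma has_sum_product_real:
  fixes f :: "'a \<Rightarrow> real" and g :: "'b \<Rightarrow> real"
  assumes "(f has_sum s) A" and "(g has_sum t) B"
  shows "((\<lambda>(x, y). f x * g y) has_sum (s * t)) (A \<times> B)"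
proof (rule has_sum_SigmaI)
  show "((\<lambda>y. case (x, y) of (x, y) \<Rightarrow> f x * g y) has_sum (f x * t)) B" for x
    using has_sum_cmult_right[OF assms(2)] by simp
  show "((\<lambda>x. f x * t) has_sum s * t) A"
    using has_sum_cmult_left[OF assms(1)] .
  have f: "(\<lambda>x. norm (f x)) summable_on A" and g: "(\<lambda>x. norm (g x)) summable_on B"
    using assms summable_on_iff_abs_summable_on_real summable_on_def by blast+
  have "(\<lambda>z. norm ((\<lambda>(x, y). f x * g y) z)) summable_on A \<times> B"
    unfolding Infinite_Sum.abs_summable_on_Sigma_iff
  proof (intro conjI ballI)
    show "(\<lambda>y. norm ((\<lambda>(x, y). f x * g y) (x, y))) summable_on B" for x
      using summable_on_cmult_right[OF g, of "norm (f x)"] by (simp add: abs_mult)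
    have "infsum (\<lambda>y. norm ((\<lambda>(x, y). f x * g y) (x, y))) B = norm (f x) * infsum (\<lambda>y. norm (g y)) B" for x
      by (simp add: abs_mult infsum_cmult_right')
    then show "(\<lambda>x. norm (infsum (\<lambda>y. norm ((\<lambda>(x, y). f x * g y) (x, y))) B)) summable_on A"
      using summable_on_cmult_left[OF f, of "norm (infsum (\<lambda>y. norm (g y)) B)"]
      by (simp add: abs_mult)
  qed
  then show "(\<lambda>(x, y). f x * g y) summable_on A \<times> B"
    by (rule Infinite_Sum.abs_summable_summable)
qed

section \<open>Sums of separated monomials in the momenta\<close>

text \<open>The class contains the Hamiltonian, the angular integral and all further integrals, and
  is closed under products; separated variables reduce analyticity to products of one-variable
  series. \<open>A\<close> and \<open>B\<close> are the sets on which the coefficients have to be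
  analytic.\<close>

inductive momentum_polynomial :: "real set \<Rightarrow> real set \<Rightarrow> (point \<Rightarrow> real) \<Rightarrow> bool" for A B where
  monomial: "\<forall>r\<in>A. holomorphic_extension_at f r \<Longrightarrow> \<forall>\<phi>\<in>B. holomorphic_extension_at g \<phi> \<Longrightarrow>
    momentum_polynomial A B (\<lambda>(r, \<phi>, p, q). f r * g \<phi> * p ^ i * q ^ j)"
| add: "momentum_polynomial A B F \<Longrightarrow> momentum_polynomial A B F' \<Longrightarrow>
    momentum_polynomial A B (\<lambda>x. F x + F' x)"

lemma momentum_polynomial_r:
  assumes "\<And>r. r \<in> A \<Longrightarrow> holomorphic_extension_at f r"
  shows "momentum_polynomial A B (\<lambda>x. f (fst x))"
  using momentum_polynomial.monomial[of A f B "\<lambda>_. 1" 0 0] assms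
  by (simp add: case_prod_beta' holomorphic_extension_at_const)

lemma momentum_polynomial_\<phi>:
  assumes "\<And>\<phi>. \<phi> \<in> B \<Longrightarrow> holomorphic_extension_at g \<phi>"
  shows "momentum_polynomial A B (\<lambda>x. g (fst (snd x)))"
  using momentum_polynomial.monomial[of A "\<lambda>_. 1" B g 0 0] assms
  by (simp add: case_prod_beta' holomorphic_extension_at_const)

lemma momentum_polynomial_const: "momentum_polynomial A B (\<lambda>x. c)"
  by (rule momentum_polynomial_r[of A "\<lambda>_. c"]) (rule holomorphic_extension_at_const)

lemma momentum_polynomial_p_r: "momentum_polynomial A B (\<lambda>x. fst (snd (snd x)))"
  using momentum_polynomial.monomial[of A "\<lambda>_. 1" B "\<lambda>_. 1" 1 0]
  by (simp add: case_prod_beta' holomorphic_extension_at_const)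

lemma momentum_polynomial_p_\<phi>: "momentum_polynomial A B (\<lambda>x. snd (snd (snd x)))"
  using momentum_polynomial.monomial[of A "\<lambda>_. 1" B "\<lambda>_. 1" 0 1]
  by (simp add: case_prod_beta' holomorphic_extension_at_const)

text \<open>Two nested inductions reduce the claim to two monomials, whose product is again a
  monomial.\<close>

lemma momentum_polynomial_mult:
  assumes "momentum_polynomial A B F" "momentum_polynomial A B F'"
  shows "momentum_polynomial A B (\<lambda>x. F x * F' x)"
  using assms(1)
proof (induction rule: momentum_polynomial.induct)
  case (monomial f g i j)
  show ?case using assms(2)
  proof (induction rule: momentum_polynomial.induct)
    case (monomial f' g' i' j')
    have "momentum_polynomial A B (\<lambda>(r, \<phi>, p, q). (f r * f' r) * (g \<phi> * g' \<phi>) * p ^ (i + i') * q ^ (j + j'))"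
      using monomial \<open>\<forall>r\<in>A. holomorphic_extension_at f r\<close> \<open>\<forall>\<phi>\<in>B. holomorphic_extension_at g \<phi>\<close>
      by (intro momentum_polynomial.monomial) (auto intro: holomorphic_extension_at_mult)
    then show ?case by (simp add: case_prod_beta' power_add mult_ac)
  next
    case (add F F')
    then show ?case by (simp add: distrib_left momentum_polynomial.add)
  qed
next
  case (add F F')
  then show ?case by (simp add: distrib_right momentum_polynomial.add)
qed

lemma momentum_polynomial_diff:
  assumes "momentum_polynomial A B F" "momentum_polynomial A B F'"
  shows "momentum_polynomial A B (\<lambda>x. F x - F' x)"
  using momentum_polynomial.add[OF assms(1) momentum_polynomial_mult[OF momentum_polynomial_const[of A B "-1"] assms(2)]]
  by simp

lemma momentum_polynomial_power:
  "momentum_polynomial A B F \<Longrightarrow> momentum_polynomial A B (\<lambda>x. F x ^ k)"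
  by (induction k) (auto intro: momentum_polynomial_const momentum_polynomial_mult)

lemmas momentum_polynomial_intros =
  momentum_polynomial.add momentum_polynomial_mult momentum_polynomial_diff
  momentum_polynomial_power momentum_polynomial_const momentum_polynomial_p_r
  momentum_polynomial_p_\<phi>

section \<open>Polynomiality in the momenta\<close>

lemma momentum_polynomial_imp_polynomial_in_momenta:
  assumes "momentum_polynomial A B F"
  shows "polynomial_in_momenta M F"
proof -
  have "\<exists>N c. \<forall>r \<phi> p q. F (r, \<phi>, p, q) = (\<Sum>i\<le>N. \<Sum>j\<le>N. c i j r \<phi> * p ^ i * q ^ j)"
    using assms
  proof (induction rule: momentum_polynomial.induct)
    case (monomial f g i j)
    \<comment> \<open>One bound has to serve both exponents, hence \<open>max i j\<close> below;
      every coefficient off \<open>(i, j)\<close> is zero.\<close>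
    define c where "c = (\<lambda>k l r \<phi>. if k = i then if l = j then f r * g \<phi> else 0 else 0)"
    have "f r * g \<phi> * p ^ i * q ^ j = (\<Sum>k\<le>max i j. \<Sum>l\<le>max i j. c k l r \<phi> * p ^ k * q ^ l)"
      for r \<phi> p q
    proof -
      have "c k l r \<phi> * p ^ k * q ^ l =
          (if l = j then if k = i then f r * g \<phi> * p ^ i * q ^ j else 0 else 0)" for k l
        by (simp add: c_def)
      then show ?thesis by simp
    qed
    then have "\<forall>r \<phi> p q. (\<lambda>(r, \<phi>, p, q). f r * g \<phi> * p ^ i * q ^ j) (r, \<phi>, p, q) =
        (\<Sum>k\<le>max i j. \<Sum>l\<le>max i j. c k l r \<phi> * p ^ k * q ^ l)"
      by simp
    then show ?case by blast
  next
    case (add F F')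
    from add.IH(1) obtain N c where
      F: "\<forall>r \<phi> p q. F (r, \<phi>, p, q) = (\<Sum>i\<le>N. \<Sum>j\<le>N. c i j r \<phi> * p ^ i * q ^ j)" by blast
    from add.IH(2) obtain N' c' where
      F': "\<forall>r \<phi> p q. F' (r, \<phi>, p, q) = (\<Sum>i\<le>N'. \<Sum>j\<le>N'. c' i j r \<phi> * p ^ i * q ^ j)" by blast
    \<comment> \<open>Zero coefficients enlarge the square of exponents, so that sums with different
      bounds can be added.\<close>
    have pad: "(\<Sum>i\<le>K. \<Sum>j\<le>K. d i j * p ^ i * q ^ j) =
        (\<Sum>i\<le>L. \<Sum>j\<le>L. (if i \<le> K \<and> j \<le> K then d i j else 0) * p ^ i * q ^ j)"
      if "K \<le> L" for K L :: nat and d and p q :: real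
    proof -
      have "(\<Sum>i\<le>K. \<Sum>j\<le>K. d i j * p ^ i * q ^ j) =
          (\<Sum>i\<le>K. \<Sum>j\<le>K. (if i \<le> K \<and> j \<le> K then d i j else 0) * p ^ i * q ^ j)"
        by simp
      also have "\<dots> = (\<Sum>i\<le>K. \<Sum>j\<le>L. (if i \<le> K \<and> j \<le> K then d i j else 0) * p ^ i * q ^ j)"
        using that by (intro sum.cong sum.mono_neutral_left) auto
      also have "\<dots> = (\<Sum>i\<le>L. \<Sum>j\<le>L. (if i \<le> K \<and> j \<le> K then d i j else 0) * p ^ i * q ^ j)"
        using that by (intro sum.mono_neutral_left) auto
      finally show ?thesis .
    qed
    define d where "d = (\<lambda>i j r \<phi>. (if i \<le> N \<and> j \<le> N then c i j r \<phi> else 0) +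
      (if i \<le> N' \<and> j \<le> N' then c' i j r \<phi> else 0))"
    have "F (r, \<phi>, p, q) + F' (r, \<phi>, p, q) =
        (\<Sum>i\<le>max N N'. \<Sum>j\<le>max N N'. d i j r \<phi> * p ^ i * q ^ j)" for r \<phi> p q
      unfolding F[rule_format] F'[rule_format] d_def
      by (simp only: pad[OF max.cobounded1[of N N']] pad[OF max.cobounded2[of N' N]]
          distrib_right sum.distrib)
    then have "\<forall>r \<phi> p q. F (r, \<phi>, p, q) + F' (r, \<phi>, p, q) =
        (\<Sum>i\<le>max N N'. \<Sum>j\<le>max N N'. d i j r \<phi> * p ^ i * q ^ j)"
      by blast
    then show ?case by blast
  qed
  then obtain N c where "\<forall>r \<phi> p q. F (r, \<phi>, p, q) = (\<Sum>i\<le>N. \<Sum>j\<le>N. c i j r \<phi> * p ^ i * q ^ j)"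
    by blast
  then show ?thesis
    unfolding polynomial_in_momenta_def by (intro exI[of _ N] exI[of _ c]) (simp only: Ball_def split_paired_All prod.case simp_thms)
qed

section \<open>Convergent power series in four variables\<close>

text \<open>The local clause of \<open>real_analytic_on\<close> at a single point, with projections
  in place of tuple patterns, in a form that passes through the induction over sums of
  monomials.\<close>

definition power_series_at :: "(point \<Rightarrow> real) \<Rightarrow> point \<Rightarrow> bool" where
  "power_series_at F x \<longleftrightarrow>
     (\<exists>\<epsilon>>0. \<exists>c :: nat \<times> nat \<times> nat \<times> nat \<Rightarrow> real. \<forall>y\<in>ball x \<epsilon>.
        ((\<lambda>i. c i * (fst y - fst x) ^ fst i * (fst (snd y) - fst (snd x)) ^ fst (snd i) *
            (fst (snd (snd y)) - fst (snd (snd x))) ^ fst (snd (snd i)) *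
            (snd (snd (snd y)) - snd (snd (snd x))) ^ snd (snd (snd i))) has_sum F y) UNIV)"

lemma real_analytic_onI:
  assumes "\<And>x. x \<in> M \<Longrightarrow> power_series_at F x"
  shows "real_analytic_on F M"
  using assms unfolding real_analytic_on_def power_series_at_def
  by (simp only: case_prod_beta' fst_conv snd_conv prod.collapse) blast

lemma power_series_at_add:
  assumes "power_series_at F x" "power_series_at F' x"
  shows "power_series_at (\<lambda>y. F y + F' y) x"
proof -
  obtain e c where F: "e > 0" "\<forall>y\<in>ball x e.
      ((\<lambda>i. c i * (fst y - fst x) ^ fst i * (fst (snd y) - fst (snd x)) ^ fst (snd i) *
            (fst (snd (snd y)) - fst (snd (snd x))) ^ fst (snd (snd i)) *
            (snd (snd (snd y)) - snd (snd (snd x))) ^ snd (snd (snd i))) has_sum F y) UNIV"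
    using assms(1) unfolding power_series_at_def by blast
  obtain e' c' where F': "e' > 0" "\<forall>y\<in>ball x e'.
      ((\<lambda>i. c' i * (fst y - fst x) ^ fst i * (fst (snd y) - fst (snd x)) ^ fst (snd i) *
            (fst (snd (snd y)) - fst (snd (snd x))) ^ fst (snd (snd i)) *
            (snd (snd (snd y)) - snd (snd (snd x))) ^ snd (snd (snd i))) has_sum F' y) UNIV"
    using assms(2) unfolding power_series_at_def by blast
  have "\<forall>y\<in>ball x (min e e').
      ((\<lambda>i. (c i + c' i) * (fst y - fst x) ^ fst i * (fst (snd y) - fst (snd x)) ^ fst (snd i) *
            (fst (snd (snd y)) - fst (snd (snd x))) ^ fst (snd (snd i)) *
            (snd (snd (snd y)) - snd (snd (snd x))) ^ snd (snd (snd i))) has_sum F y + F' y) UNIV"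
  proof
    fix y assume "y \<in> ball x (min e e')"
    then have "y \<in> ball x e" "y \<in> ball x e'" by simp_all
    then show "((\<lambda>i. (c i + c' i) * (fst y - fst x) ^ fst i * (fst (snd y) - fst (snd x)) ^ fst (snd i) *
            (fst (snd (snd y)) - fst (snd (snd x))) ^ fst (snd (snd i)) *
            (snd (snd (snd y)) - snd (snd (snd x))) ^ snd (snd (snd i))) has_sum F y + F' y) UNIV"
      unfolding distrib_right by (intro has_sum_add F(2)[rule_format] F'(2)[rule_format])
  qed
  then show ?thesis
    unfolding power_series_at_def using F(1) F'(1)
    by (intro exI[of _ "min e e'"] conjI exI[of _ "\<lambda>i. c i + c' i"]) simp_all
qed

text \<open>Multiplying out the four one-variable series gives a series over quadruples, whose
  coefficients are the products of theirs.\<close>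

lemma power_series_at_separated:
  assumes "holomorphic_extension_at f1 (fst x)" "holomorphic_extension_at f2 (fst (snd x))"
    "holomorphic_extension_at f3 (fst (snd (snd x)))" "holomorphic_extension_at f4 (snd (snd (snd x)))"
  shows "power_series_at
    (\<lambda>y. f1 (fst y) * f2 (fst (snd y)) * f3 (fst (snd (snd y))) * f4 (snd (snd (snd y)))) x"
proof -
  obtain x1 x2 x3 x4 where x: "x = (x1, x2, x3, x4)" by (cases x)
  obtain e1 a1 where 1: "e1 > 0"
      "\<forall>t. \<bar>t - x1\<bar> < e1 \<longrightarrow> ((\<lambda>i. a1 i * (t - x1) ^ i) has_sum f1 t) UNIV"
    using holomorphic_extension_at_has_sum[OF assms(1)] unfolding x fst_conv snd_conv by blast
  obtain e2 a2 where 2: "e2 > 0"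
      "\<forall>t. \<bar>t - x2\<bar> < e2 \<longrightarrow> ((\<lambda>i. a2 i * (t - x2) ^ i) has_sum f2 t) UNIV"
    using holomorphic_extension_at_has_sum[OF assms(2)] unfolding x fst_conv snd_conv by blast
  obtain e3 a3 where 3: "e3 > 0"
      "\<forall>t. \<bar>t - x3\<bar> < e3 \<longrightarrow> ((\<lambda>i. a3 i * (t - x3) ^ i) has_sum f3 t) UNIV"
    using holomorphic_extension_at_has_sum[OF assms(3)] unfolding x fst_conv snd_conv by blast
  obtain e4 a4 where 4: "e4 > 0"
      "\<forall>t. \<bar>t - x4\<bar> < e4 \<longrightarrow> ((\<lambda>i. a4 i * (t - x4) ^ i) has_sum f4 t) UNIV"
    using holomorphic_extension_at_has_sum[OF assms(4)] unfolding x fst_conv snd_conv by blast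
  define e where "e = min (min e1 e2) (min e3 e4)"
  have sum: "((\<lambda>i. (a1 (fst i) * a2 (fst (snd i)) * a3 (fst (snd (snd i))) * a4 (snd (snd (snd i)))) *
            (y1 - x1) ^ fst i * (y2 - x2) ^ fst (snd i) *
            (y3 - x3) ^ fst (snd (snd i)) * (y4 - x4) ^ snd (snd (snd i)))
          has_sum f1 y1 * f2 y2 * f3 y3 * f4 y4) UNIV"
    if "dist (x1, x2, x3, x4) (y1, y2, y3, y4) < e" for y1 y2 y3 y4
  proof -
    \<comment> \<open>Each coordinate distance is bounded by the distance of the points, so the ball
      lies inside all four intervals of convergence.\<close>
    have "dist x1 y1 \<le> dist (x1, x2, x3, x4) (y1, y2, y3, y4)"
      using dist_fst_le[of "(x1, x2, x3, x4)" "(y1, y2, y3, y4)"] by simp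
    moreover have s: "dist (x2, x3, x4) (y2, y3, y4) \<le> dist (x1, x2, x3, x4) (y1, y2, y3, y4)"
      using dist_snd_le[of "(x1, x2, x3, x4)" "(y1, y2, y3, y4)"] by simp
    moreover have "dist x2 y2 \<le> dist (x2, x3, x4) (y2, y3, y4)"
      using dist_fst_le[of "(x2, x3, x4)" "(y2, y3, y4)"] by simp
    moreover have "dist (x3, x4) (y3, y4) \<le> dist (x2, x3, x4) (y2, y3, y4)"
      using dist_snd_le[of "(x2, x3, x4)" "(y2, y3, y4)"] by simp
    moreover have "dist x3 y3 \<le> dist (x3, x4) (y3, y4)"
      using dist_fst_le[of "(x3, x4)" "(y3, y4)"] by simp
    moreover have "dist x4 y4 \<le> dist (x3, x4) (y3, y4)"
      using dist_snd_le[of "(x3, x4)" "(y3, y4)"] by simp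
    ultimately have "\<bar>y1 - x1\<bar> < e1" "\<bar>y2 - x2\<bar> < e2" "\<bar>y3 - x3\<bar> < e3" "\<bar>y4 - x4\<bar> < e4"
      using that by (auto simp: e_def dist_real_def)
    then have "((\<lambda>(i, j, k, l). (a1 i * (y1 - x1) ^ i) * ((a2 j * (y2 - x2) ^ j) *
        ((a3 k * (y3 - x3) ^ k) * (a4 l * (y4 - x4) ^ l)))) has_sum
        (f1 y1 * (f2 y2 * (f3 y3 * f4 y4)))) (UNIV \<times> UNIV \<times> UNIV \<times> UNIV)"
      using has_sum_product_real[OF 1(2)[rule_format] has_sum_product_real[OF 2(2)[rule_format]
          has_sum_product_real[OF 3(2)[rule_format] 4(2)[rule_format]]]]
      by (simp add: case_prod_beta')
    then show ?thesis by (simp only: case_prod_beta' mult_ac UNIV_Times_UNIV)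
  qed
  have "\<forall>y\<in>ball x e.
      ((\<lambda>i. (a1 (fst i) * a2 (fst (snd i)) * a3 (fst (snd (snd i))) * a4 (snd (snd (snd i)))) *
            (fst y - fst x) ^ fst i * (fst (snd y) - fst (snd x)) ^ fst (snd i) *
            (fst (snd (snd y)) - fst (snd (snd x))) ^ fst (snd (snd i)) *
            (snd (snd (snd y)) - snd (snd (snd x))) ^ snd (snd (snd i)))
          has_sum f1 (fst y) * f2 (fst (snd y)) * f3 (fst (snd (snd y))) * f4 (snd (snd (snd y)))) UNIV"
    (is "\<forall>y\<in>_. ?P y")
  proof
    fix y assume "y \<in> ball x e"
    then show "?P y"
      using sum[of "fst y" "fst (snd y)" "fst (snd (snd y))" "snd (snd (snd y))"]
      by (simp only: x mem_ball prod.collapse fst_conv snd_conv)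
  qed
  moreover have "e > 0" using 1(1) 2(1) 3(1) 4(1) by (simp add: e_def)
  ultimately show ?thesis
    unfolding power_series_at_def by (intro exI conjI)
qed

lemma momentum_polynomial_imp_real_analytic_on:
  assumes "momentum_polynomial A B F" and M: "\<And>x. x \<in> M \<Longrightarrow> fst x \<in> A \<and> fst (snd x) \<in> B"
  shows "real_analytic_on F M"
proof (rule real_analytic_onI)
  fix x assume "x \<in> M"
  then have x: "fst x \<in> A" "fst (snd x) \<in> B" using M by auto
  show "power_series_at F x"
    using assms(1)
  proof (induction rule: momentum_polynomial.induct)
    case (monomial f g i j)
    then show ?case
      using power_series_at_separated[of f x g "\<lambda>p. p ^ i" "\<lambda>q. q ^ j"] x
      by (simp add: case_prod_beta' holomorphic_extension_at_power holomorphic_extension_at_id)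
  next
    case (add F F')
    then show ?case by (simp add: power_series_at_add)
  qed
qed

section \<open>Powers in a quadratic extension\<close>

text \<open>The components of \<open>(u + s v) ^ k\<close> with respect to \<open>1, s\<close>, where \<open>s\<close> is a formal
  square root of \<open>- D\<close>.\<close>

fun qpow_re qpow_im :: "real \<Rightarrow> real \<Rightarrow> real \<Rightarrow> nat \<Rightarrow> real" where
  "qpow_re D u v 0 = 1"
| "qpow_im D u v 0 = 0"
| "qpow_re D u v (Suc k) = u * qpow_re D u v k - D * v * qpow_im D u v k"
| "qpow_im D u v (Suc k) = u * qpow_im D u v k + v * qpow_re D u v k"

text \<open>\<open>u\<^sup>2 + D * v\<^sup>2\<close> is the norm of the quadratic extension, and the
  norm is multiplicative.\<close>

lemma qpow_norm: "(qpow_re D u v k)\<^sup>2 + D * (qpow_im D u v k)\<^sup>2 = (u\<^sup>2 + D * v\<^sup>2) ^ k"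
proof (induction k)
  case (Suc k)
  have "(qpow_re D u v (Suc k))\<^sup>2 + D * (qpow_im D u v (Suc k))\<^sup>2 =
      (u\<^sup>2 + D * v\<^sup>2) * ((qpow_re D u v k)\<^sup>2 + D * (qpow_im D u v k)\<^sup>2)"
    by (simp add: power2_eq_square algebra_simps)
  then show ?case by (simp add: Suc)
qed simp

section \<open>Binomial expansion of the two components\<close>

text \<open>With \<open>e i\<close> standing for the \<open>i\<close>-th power of \<open>s\<close>
  this is the expansion of \<open>(u + s v) ^ k\<close>. An arbitrary real sequence \<open>e\<close>
  lets the two components of the powers of \<open>s\<close> be inserted one at a time.\<close>

definition weighted_binomial_sum :: "(nat \<Rightarrow> real) \<Rightarrow> real \<Rightarrow> real \<Rightarrow> nat \<Rightarrow> real" where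
  "weighted_binomial_sum e u v k = (\<Sum>i\<le>k. real (k choose i) * e i * v ^ i * u ^ (k - i))"

text \<open>Pascal's rule; shifting \<open>e\<close> plays the role of multiplication by
  \<open>s\<close>.\<close>

lemma weighted_binomial_sum_Suc:
  "weighted_binomial_sum e u v (Suc k) =
     u * weighted_binomial_sum e u v k + v * weighted_binomial_sum (\<lambda>i. e (Suc i)) u v k"
proof -
  have "weighted_binomial_sum e u v (Suc k) =
      e 0 * u ^ Suc k + (\<Sum>i\<le>k. real (Suc k choose Suc i) * e (Suc i) * v ^ Suc i * u ^ (k - i))"
    unfolding weighted_binomial_sum_def by (subst sum.atMost_Suc_shift) simp
  also have "(\<Sum>i\<le>k. real (Suc k choose Suc i) * e (Suc i) * v ^ Suc i * u ^ (k - i)) =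
      v * weighted_binomial_sum (\<lambda>i. e (Suc i)) u v k +
      (\<Sum>i\<le>k. real (k choose Suc i) * e (Suc i) * v ^ Suc i * u ^ (k - i))"
    unfolding weighted_binomial_sum_def
    by (simp add: algebra_simps sum.distrib sum_distrib_left)
  also have "(\<Sum>i\<le>k. real (k choose Suc i) * e (Suc i) * v ^ Suc i * u ^ (k - i)) =
      (\<Sum>i<k. real (k choose Suc i) * e (Suc i) * v ^ Suc i * u ^ (k - i))"
    by (rule sum.mono_neutral_right) auto
  also have "\<dots> = (\<Sum>i<k. u * (real (k choose Suc i) * e (Suc i) * v ^ Suc i * u ^ (k - Suc i)))"
    by (rule sum.cong) (auto simp: Suc_diff_Suc simp flip: power_Suc)
  finally have "weighted_binomial_sum e u v (Suc k) = e 0 * u ^ Suc k +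
      (\<Sum>i<k. u * (real (k choose Suc i) * e (Suc i) * v ^ Suc i * u ^ (k - Suc i))) +
      v * weighted_binomial_sum (\<lambda>i. e (Suc i)) u v k"
    by simp
  moreover have "u * weighted_binomial_sum e u v k = e 0 * u ^ Suc k +
      (\<Sum>i<k. u * (real (k choose Suc i) * e (Suc i) * v ^ Suc i * u ^ (k - Suc i)))"
    unfolding weighted_binomial_sum_def sum.atMost_shift
    by (simp add: distrib_left sum_distrib_left)
  ultimately show ?thesis by simp
qed

text \<open>The two weight sequences are the components of the powers of \<open>s\<close>. A shift
  exchanges them up to a factor \<open>- D\<close>, which is the recursion of \<open>qpow_re\<close>
  and \<open>qpow_im\<close>.\<close>

lemma qpow_eq_weighted_binomial_sum:
  "qpow_re D u v k = weighted_binomial_sum (\<lambda>i. if even i then (- D) ^ (i div 2) else 0) u v k"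
  "qpow_im D u v k = weighted_binomial_sum (\<lambda>i. if odd i then (- D) ^ (i div 2) else 0) u v k"
proof (induction k)
  case 0
  { case 1 show ?case by (simp add: weighted_binomial_sum_def) }
  { case 2 show ?case by (simp add: weighted_binomial_sum_def) }
next
  case (Suc k)
  have even: "(\<lambda>i. if even (Suc i) then (- D) ^ (Suc i div 2) else 0) =
      (\<lambda>i. - D * (if odd i then (- D) ^ (i div 2) else 0))"
    by (auto simp: fun_eq_iff elim!: oddE)
  have scale: "weighted_binomial_sum (\<lambda>i. - D * e i) u v k = - D * weighted_binomial_sum e u v k" for e
    unfolding weighted_binomial_sum_def sum_distrib_left by (simp add: mult_ac)
  { case 1 show ?case by (simp only: weighted_binomial_sum_Suc Suc qpow_re.simps even scale) simp }
  have odd: "(\<lambda>i. if odd (Suc i) then (- D) ^ (Suc i div 2) else 0) =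
      (\<lambda>i. if even i then (- D) ^ (i div 2) else 0)"
    by (auto simp: fun_eq_iff)
  { case 2 show ?case by (simp only: weighted_binomial_sum_Suc Suc qpow_im.simps odd) }
qed

text \<open>Only even indices contribute. The sum is then reversed so that \<open>u\<close> carries
  the exponent \<open>2 * j\<close>, as the radial momentum does in \<open>I_1\<close> and
  \<open>I_2\<close>.\<close>

lemma qpow_re_even:
  "qpow_re D u v (2 * n) = (\<Sum>j=0..n. real ((2 * n) choose (2 * j)) * (- D) ^ (n - j) * v ^ (2 * n - 2 * j) * u ^ (2 * j))"
proof -
  \<comment> \<open>The extra index \<open>Suc (2 * n)\<close> has a zero binomial coefficient and
    lets the range split into pairs of an even and an odd index.\<close>
  have "qpow_re D u v (2 * n) = (\<Sum>i\<le>Suc (2 * n). real ((2 * n) choose i) *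
      (if even i then (- D) ^ (i div 2) else 0) * v ^ i * u ^ (2 * n - i))"
    by (simp add: qpow_eq_weighted_binomial_sum weighted_binomial_sum_def)
  also have "\<dots> = (\<Sum>j\<le>n. real ((2 * n) choose (2 * j)) * (- D) ^ j * v ^ (2 * j) * u ^ (2 * n - 2 * j))"
    unfolding sum.in_pairs_0 by simp
  also have "\<dots> = (\<Sum>j\<le>n. real ((2 * n) choose (2 * (n - j))) * (- D) ^ (n - j) * v ^ (2 * (n - j)) * u ^ (2 * n - 2 * (n - j)))"
    by (rule sum.reindex_bij_witness[of _ "\<lambda>j. n - j" "\<lambda>j. n - j"]) auto
  also have "\<dots> = (\<Sum>j\<le>n. real ((2 * n) choose (2 * j)) * (- D) ^ (n - j) * v ^ (2 * n - 2 * j) * u ^ (2 * j))"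
  proof (rule sum.cong)
    fix j assume "j \<in> {..n}"
    then have "2 * n - 2 * (n - j) = 2 * j" "2 * (n - j) = 2 * n - 2 * j" "2 * j \<le> 2 * n" by auto
    then show "real ((2 * n) choose (2 * (n - j))) * (- D) ^ (n - j) * v ^ (2 * (n - j)) * u ^ (2 * n - 2 * (n - j)) =
        real ((2 * n) choose (2 * j)) * (- D) ^ (n - j) * v ^ (2 * n - 2 * j) * u ^ (2 * j)"
      using binomial_symmetric[of "2 * j" "2 * n"] by simp
  qed simp
  finally show ?thesis by (simp add: atMost_atLeast0)
qed

text \<open>Two absorption identities share the value
  \<open>2 * n * ((2 * n - 1) choose (2 * j))\<close>. The ratio is the source of the fractions in
  \<open>I_1\<close> and \<open>I_2\<close>.\<close>

lemma binomial_odd_ratio: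
  assumes "j \<le> n"
  shows "real ((2 * n) choose (2 * j + 1)) =
    real ((2 * n) choose (2 * j)) * (2 * real (n - j) / real (2 * j + 1))"
proof -
  have "Suc (2 * j) * ((2 * n) choose Suc (2 * j)) = (2 * n - 2 * j) * ((2 * n) choose (2 * j))"
    using binomial_absorb_comp[of "2 * n" "2 * j"] binomial_absorption[of "2 * j" "2 * n"] by simp
  then have "real (Suc (2 * j)) * real ((2 * n) choose Suc (2 * j)) =
      real (2 * (n - j)) * real ((2 * n) choose (2 * j))"
    by (simp only: diff_mult_distrib2 flip: of_nat_mult)
  then show ?thesis by (simp add: field_simps)
qed

text \<open>The factor \<open>D\<close> raises the exponent of \<open>- D\<close> from
  \<open>n - Suc j\<close> to \<open>n - j\<close> at the price of a sign, so that the coefficients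
  match those of \<open>qpow_re_even\<close> up to the binomial ratio.\<close>

lemma D_qpow_im_even:
  "D * qpow_im D u v (2 * n) = - (\<Sum>j=0..n. real ((2 * n) choose (2 * j)) * (- D) ^ (n - j) *
     v ^ (2 * n - 2 * j - 1) * u ^ (2 * j) * (2 * real (n - j) / real (2 * j + 1) * u))"
proof -
  have "qpow_im D u v (2 * n) = (\<Sum>i\<le>Suc (2 * n). real ((2 * n) choose i) *
      (if odd i then (- D) ^ (i div 2) else 0) * v ^ i * u ^ (2 * n - i))"
    by (simp add: qpow_eq_weighted_binomial_sum weighted_binomial_sum_def)
  also have "\<dots> = (\<Sum>j\<le>n. real ((2 * n) choose (Suc (2 * j))) * (- D) ^ j * v ^ (Suc (2 * j)) * u ^ (2 * n - Suc (2 * j)))"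
    unfolding sum.in_pairs_0 by simp
  \<comment> \<open>The term \<open>j = n\<close> has a zero binomial coefficient; without it the
    range can be reversed by sending \<open>j\<close> to \<open>n - Suc j\<close>.\<close>
  also have "\<dots> = (\<Sum>j<n. real ((2 * n) choose (Suc (2 * j))) * (- D) ^ j * v ^ (Suc (2 * j)) * u ^ (2 * n - Suc (2 * j)))"
    by (rule sum.mono_neutral_right) auto
  also have "\<dots> = (\<Sum>j<n. real ((2 * n) choose (2 * j + 1)) * (- D) ^ (n - Suc j) * v ^ (2 * n - 2 * j - 1) * u ^ (2 * j + 1))"
  proof (rule sum.reindex_bij_witness[of _ "\<lambda>j. n - Suc j" "\<lambda>j. n - Suc j"])
    fix j assume "j \<in> {..<n}"
    then have "2 * n - 2 * (n - Suc j) - 1 = Suc (2 * j)" "n - Suc (n - Suc j) = j"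
        "2 * (n - Suc j) + 1 = 2 * n - Suc (2 * j)" "Suc (2 * j) \<le> 2 * n" by auto
    then show "real ((2 * n) choose (2 * (n - Suc j) + 1)) * (- D) ^ (n - Suc (n - Suc j)) * v ^ (2 * n - 2 * (n - Suc j) - 1) * u ^ (2 * (n - Suc j) + 1) =
        real ((2 * n) choose (Suc (2 * j))) * (- D) ^ j * v ^ (Suc (2 * j)) * u ^ (2 * n - Suc (2 * j))"
      using binomial_symmetric[of "Suc (2 * j)" "2 * n"] by simp
  qed auto
  finally have "D * qpow_im D u v (2 * n) = (\<Sum>j<n. D * (real ((2 * n) choose (2 * j + 1)) *
      (- D) ^ (n - Suc j) * v ^ (2 * n - 2 * j - 1) * u ^ (2 * j + 1)))"
    by (simp only: sum_distrib_left)
  also have "\<dots> = (\<Sum>j<n. - (real ((2 * n) choose (2 * j)) * (- D) ^ (n - j) *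
     v ^ (2 * n - 2 * j - 1) * u ^ (2 * j) * (2 * real (n - j) / real (2 * j + 1) * u)))"
  proof (rule sum.cong)
    fix j assume j: "j \<in> {..<n}"
    then have "D * (- D) ^ (n - Suc j) = - ((- D) ^ (n - j))"
      by (metis Suc_diff_Suc lessThan_iff minus_mult_left power_Suc minus_minus)
    moreover have "D * (real ((2 * n) choose (2 * j + 1)) *
        (- D) ^ (n - Suc j) * v ^ (2 * n - 2 * j - 1) * u ^ (2 * j + 1)) =
        (D * (- D) ^ (n - Suc j)) * real ((2 * n) choose (2 * j + 1)) * v ^ (2 * n - 2 * j - 1) * u ^ (2 * j) * u"
      by (simp add: mult_ac)
    ultimately show "D * (real ((2 * n) choose (2 * j + 1)) *
      (- D) ^ (n - Suc j) * v ^ (2 * n - 2 * j - 1) * u ^ (2 * j + 1)) =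
      - (real ((2 * n) choose (2 * j)) * (- D) ^ (n - j) *
     v ^ (2 * n - 2 * j - 1) * u ^ (2 * j) * (2 * real (n - j) / real (2 * j + 1) * u))"
      using j by (simp only: binomial_odd_ratio lessThan_iff less_imp_le) (simp add: mult_ac)
  qed simp
  \<comment> \<open>The term \<open>j = n\<close> returns: the factor \<open>real (n - j)\<close>
    annihilates it, whatever the truncated exponent of \<open>v\<close> is.\<close>
  also have "\<dots> = - (\<Sum>j=0..n. real ((2 * n) choose (2 * j)) * (- D) ^ (n - j) *
     v ^ (2 * n - 2 * j - 1) * u ^ (2 * j) * (2 * real (n - j) / real (2 * j + 1) * u))"
    unfolding sum_negf by (intro arg_cong[where f = uminus] sum.mono_neutral_left) auto
  finally show ?thesis .
qed

section \<open>Directional derivatives\<close>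

text \<open>Differentiability is part of the predicate, so sum, product and chain rules carry no
  side conditions and a Poisson bracket is obtained from one derivative along a vector
  field.\<close>

definition has_dir_deriv :: "('a::real_normed_vector \<Rightarrow> real) \<Rightarrow> 'a \<Rightarrow> 'a \<Rightarrow> real \<Rightarrow> bool" where
  "has_dir_deriv F x X d \<longleftrightarrow> (\<exists>F'. (F has_derivative F') (at x) \<and> F' X = d)"

lemma has_dir_deriv_frechet: "has_dir_deriv F x X d \<Longrightarrow> frechet_derivative F (at x) X = d"
  unfolding has_dir_deriv_def using frechet_derivative_at by metis

lemma has_dir_deriv_differentiable: "has_dir_deriv F x X d \<Longrightarrow> F differentiable (at x)"
  unfolding has_dir_deriv_def differentiable_def by blast

lemma has_dir_deriv_const: "has_dir_deriv (\<lambda>_. c) x X 0"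
  unfolding has_dir_deriv_def by (intro exI[of _ "\<lambda>_. 0"]) auto

lemma has_dir_deriv_linear: "bounded_linear F \<Longrightarrow> has_dir_deriv F x X (F X)"
  unfolding has_dir_deriv_def using bounded_linear_imp_has_derivative by blast

lemma has_dir_deriv_add:
  assumes "has_dir_deriv F x X d" "has_dir_deriv F' x X d'"
  shows "has_dir_deriv (\<lambda>y. F y + F' y) x X (d + d')"
  using assms has_derivative_add unfolding has_dir_deriv_def by blast

lemma has_dir_deriv_diff:
  assumes "has_dir_deriv F x X d" "has_dir_deriv F' x X d'"
  shows "has_dir_deriv (\<lambda>y. F y - F' y) x X (d - d')"
  using assms has_derivative_diff unfolding has_dir_deriv_def by blast

lemma has_dir_deriv_mult:
  assumes "has_dir_deriv F x X d" "has_dir_deriv F' x X d'"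
  shows "has_dir_deriv (\<lambda>y. F y * F' y) x X (F x * d' + d * F' x)"
  using assms has_derivative_mult[of F _ x UNIV F'] unfolding has_dir_deriv_def by fastforce

lemma has_dir_deriv_comp:
  assumes "(f has_real_derivative f') (at (F x))" "has_dir_deriv F x X d"
  shows "has_dir_deriv (\<lambda>y. f (F y)) x X (f' * d)"
  using assms has_derivative_compose[of F _ x UNIV f "(*) f'"]
  unfolding has_dir_deriv_def has_field_derivative_def by blast

lemma has_dir_deriv_eq: "has_dir_deriv F x X d \<Longrightarrow> d = d' \<Longrightarrow> has_dir_deriv F x X d'"
  by simp

text \<open>If \<open>u + s v\<close> rotates with frequency \<open>\<omega>\<close>, its \<open>k\<close>-th power rotates with frequency \<open>k \<omega>\<close>.\<close>

lemma has_dir_deriv_qpow: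
  assumes D: "has_dir_deriv D x X 0"
    and u: "has_dir_deriv u x X (- \<omega> * D x * v x)" and v: "has_dir_deriv v x X (\<omega> * u x)"
  shows "has_dir_deriv (\<lambda>y. qpow_re (D y) (u y) (v y) k) x X
      (- (real k * \<omega>) * D x * qpow_im (D x) (u x) (v x) k)"
    and "has_dir_deriv (\<lambda>y. qpow_im (D y) (u y) (v y) k) x X
      (real k * \<omega> * qpow_re (D x) (u x) (v x) k)"
proof (induction k)
  case 0
  { case 1 show ?case by (simp add: has_dir_deriv_const) }
  { case 2 show ?case by (simp add: has_dir_deriv_const) }
next
  case (Suc k)
  { case 1 show ?case unfolding qpow_re.simps
      by (rule has_dir_deriv_eq[OF has_dir_deriv_diff[OF has_dir_deriv_mult[OF u Suc(1)]
              has_dir_deriv_mult[OF has_dir_deriv_mult[OF D v] Suc(2)]]])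
        (simp add: algebra_simps) }
  { case 2 show ?case unfolding qpow_im.simps
      by (rule has_dir_deriv_eq[OF has_dir_deriv_add[OF has_dir_deriv_mult[OF u Suc(2)]
              has_dir_deriv_mult[OF v Suc(1)]]])
        (simp add: algebra_simps) }
qed

section \<open>The trigonometric functions of curvature \<open>\<kappa>\<close>\<close>

lemma C_kappa_S_kappa_squared: "(C_kappa \<kappa> r)\<^sup>2 + \<kappa> * (S_kappa \<kappa> r)\<^sup>2 = 1"
  by (auto simp: C_kappa_def S_kappa_def power_divide cosh_square_eq)

lemma S_kappa_deriv: "(S_kappa \<kappa> has_real_derivative C_kappa \<kappa> r) (at r)"
proof -
  have sin: "((\<lambda>x. sin (s * x) / s) has_real_derivative cos (s * r)) (at r)"
    and sinh: "((\<lambda>x. sinh (s * x) / s) has_real_derivative cosh (s * r)) (at r)"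
    if "s \<noteq> 0" for s :: real
    using that by (auto intro!: derivative_eq_intros)
  consider "\<kappa> > 0" | "\<kappa> = 0" | "\<kappa> < 0" by linarith
  then show ?thesis
    by cases (use sin[of "sqrt \<kappa>"] sinh[of "sqrt (- \<kappa>)"] in
      \<open>simp_all add: S_kappa_def[abs_def] C_kappa_def\<close>)
qed

lemma C_kappa_deriv: "(C_kappa \<kappa> has_real_derivative - \<kappa> * S_kappa \<kappa> r) (at r)"
proof -
  have cos: "((\<lambda>x. cos (s * x)) has_real_derivative - s\<^sup>2 * (sin (s * r) / s)) (at r)"
    and cosh: "((\<lambda>x. cosh (s * x)) has_real_derivative s\<^sup>2 * (sinh (s * r) / s)) (at r)"
    if "s \<noteq> 0" for s :: real
    using that by (auto intro!: derivative_eq_intros simp: power2_eq_square)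
  consider "\<kappa> > 0" | "\<kappa> = 0" | "\<kappa> < 0" by linarith
  then show ?thesis
    by cases (use cos[of "sqrt \<kappa>"] cosh[of "sqrt (- \<kappa>)"] in
      \<open>simp_all add: S_kappa_def C_kappa_def[abs_def]\<close>)
qed

lemma holomorphic_extension_at_S_kappa: "holomorphic_extension_at (S_kappa \<kappa>) r"
proof -
  consider "\<kappa> > 0" | "\<kappa> = 0" | "\<kappa> < 0" by linarith
  then show ?thesis
  proof cases
    case 1
    then show ?thesis
      by (intro holomorphic_extension_at_entire[of "\<lambda>z. sin (of_real (sqrt \<kappa>) * z) / of_real (sqrt \<kappa>)"])
        (auto simp: S_kappa_def sin_of_real simp flip: of_real_mult intro!: holomorphic_intros)
  next
    case 2
    then show ?thesis
      by (intro holomorphic_extension_at_entire[of "\<lambda>z. z"]) (auto simp: S_kappa_def)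
  next
    case 3
    then show ?thesis
      by (intro holomorphic_extension_at_entire[of "\<lambda>z. (exp (of_real (sqrt (- \<kappa>)) * z) -
            exp (- (of_real (sqrt (- \<kappa>)) * z))) / of_real 2 / of_real (sqrt (- \<kappa>))"])
        (auto simp: S_kappa_def sinh_field_def exp_of_real simp flip: of_real_mult of_real_minus of_real_diff of_real_add of_real_divide simp del: of_real_numeral intro!: holomorphic_intros)
  qed
qed

lemma holomorphic_extension_at_C_kappa: "holomorphic_extension_at (C_kappa \<kappa>) r"
proof -
  consider "\<kappa> > 0" | "\<kappa> = 0" | "\<kappa> < 0" by linarith
  then show ?thesis
  proof cases
    case 1
    then show ?thesis
      by (intro holomorphic_extension_at_entire[of "\<lambda>z. cos (of_real (sqrt \<kappa>) * z)"])
        (auto simp: C_kappa_def cos_of_real simp flip: of_real_mult intro!: holomorphic_intros)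
  next
    case 2
    then show ?thesis
      by (intro holomorphic_extension_at_entire[of "\<lambda>z. 1"]) (auto simp: C_kappa_def)
  next
    case 3
    then show ?thesis
      by (intro holomorphic_extension_at_entire[of "\<lambda>z. (exp (of_real (sqrt (- \<kappa>)) * z) +
            exp (- (of_real (sqrt (- \<kappa>)) * z))) / of_real 2"])
        (auto simp: C_kappa_def cosh_field_def exp_of_real simp flip: of_real_mult of_real_minus of_real_diff of_real_add of_real_divide simp del: of_real_numeral intro!: holomorphic_intros)
  qed
qed

lemma holomorphic_extension_at_cos: "holomorphic_extension_at (\<lambda>t. cos (c * t)) x"
  by (intro holomorphic_extension_at_entire[of "\<lambda>z. cos (of_real c * z)"])
    (auto simp: cos_of_real simp flip: of_real_mult intro!: holomorphic_intros)

lemma holomorphic_extension_at_sin: "holomorphic_extension_at (\<lambda>t. sin (c * t)) x"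
  by (intro holomorphic_extension_at_entire[of "\<lambda>z. sin (of_real c * z)"])
    (auto simp: sin_of_real simp flip: of_real_mult intro!: holomorphic_intros)

lemma holomorphic_extension_at_potential:
  assumes "sin (n * \<phi>) \<noteq> 0" "cos (n * \<phi>) \<noteq> 0"
  shows "holomorphic_extension_at (potential a b n) \<phi>"
proof -
  have "potential a b n = (\<lambda>\<phi>. a * inverse (cos (n * \<phi>) ^ 2) + b * inverse (sin (n * \<phi>) ^ 2))"
    by (simp add: potential_def fun_eq_iff divide_inverse)
  then show ?thesis using assms
    by (auto intro!: holomorphic_extension_at_add holomorphic_extension_at_mult
        holomorphic_extension_at_const holomorphic_extension_at_inverse
        holomorphic_extension_at_power holomorphic_extension_at_cos holomorphic_extension_at_sin)
qed

definition cot_kappa :: "real \<Rightarrow> real \<Rightarrow> real" where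
  "cot_kappa \<kappa> r = C_kappa \<kappa> r / S_kappa \<kappa> r"

text \<open>By \<open>C_kappa_S_kappa_squared\<close> the numerator of the quotient rule is -1. The
  curvature thus drops out, and the radial phase rotates by the same law for every \<kappa>.\<close>

lemma cot_kappa_deriv:
  assumes "S_kappa \<kappa> r \<noteq> 0"
  shows "(cot_kappa \<kappa> has_real_derivative - (1 / (S_kappa \<kappa> r)\<^sup>2)) (at r)"
proof -
  have "((\<lambda>r. C_kappa \<kappa> r / S_kappa \<kappa> r) has_real_derivative
      (- \<kappa> * S_kappa \<kappa> r * S_kappa \<kappa> r - C_kappa \<kappa> r * C_kappa \<kappa> r) / (S_kappa \<kappa> r * S_kappa \<kappa> r)) (at r)"
    by (rule DERIV_divide[OF C_kappa_deriv S_kappa_deriv assms])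
  moreover have "- \<kappa> * S_kappa \<kappa> r * S_kappa \<kappa> r - C_kappa \<kappa> r * C_kappa \<kappa> r = - 1"
    using C_kappa_S_kappa_squared[of \<kappa> r] by (simp add: power2_eq_square algebra_simps)
  ultimately show ?thesis
    by (simp add: cot_kappa_def[abs_def] power2_eq_square)
qed

lemma inverse_S_kappa_squared_deriv:
  assumes "S_kappa \<kappa> r \<noteq> 0"
  shows "((\<lambda>r. 1 / (S_kappa \<kappa> r)\<^sup>2) has_real_derivative - (2 * C_kappa \<kappa> r / (S_kappa \<kappa> r) ^ 3)) (at r)"
  using assms
  by (auto intro!: derivative_eq_intros S_kappa_deriv simp: field_simps power2_eq_square power3_eq_cube)

lemma holomorphic_extension_at_cot_kappa:
  assumes "S_kappa \<kappa> r \<noteq> 0"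
  shows "holomorphic_extension_at (cot_kappa \<kappa>) r"
  using holomorphic_extension_at_mult[OF holomorphic_extension_at_C_kappa
      holomorphic_extension_at_inverse[OF holomorphic_extension_at_S_kappa assms]]
  by (simp add: cot_kappa_def[abs_def] divide_inverse)

lemma holomorphic_extension_at_inverse_S_kappa_squared:
  assumes "S_kappa \<kappa> r \<noteq> 0"
  shows "holomorphic_extension_at (\<lambda>r. 1 / (S_kappa \<kappa> r)\<^sup>2) r"
  using holomorphic_extension_at_inverse[OF holomorphic_extension_at_power[OF holomorphic_extension_at_S_kappa]] assms
  by (simp add: divide_inverse)

section \<open>Hamiltonian vector fields\<close>

definition potential_deriv :: "real \<Rightarrow> real \<Rightarrow> real \<Rightarrow> real \<Rightarrow> real" where
  "potential_deriv a b n \<phi> =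
     2 * n * a * sin (n * \<phi>) / cos (n * \<phi>) ^ 3 - 2 * n * b * cos (n * \<phi>) / sin (n * \<phi>) ^ 3"

lemma potential_has_deriv:
  assumes "sin (n * \<phi>) \<noteq> 0" "cos (n * \<phi>) \<noteq> 0"
  shows "(potential a b n has_real_derivative potential_deriv a b n \<phi>) (at \<phi>)"
proof -
  have "((\<lambda>\<phi>. a / (cos (n * \<phi>))\<^sup>2 + b / (sin (n * \<phi>))\<^sup>2) has_real_derivative potential_deriv a b n \<phi>) (at \<phi>)"
    using assms
    by (auto intro!: derivative_eq_intros
        simp: potential_deriv_def field_simps power2_eq_square power3_eq_cube)
  then show ?thesis by (simp add: potential_def[abs_def])
qed

lemma angular_integral_eq:
  "angular_integral a b n = (\<lambda>x. 1 / 2 * (snd (snd (snd x)))\<^sup>2 + potential a b n (fst (snd x)))"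
  by (simp add: angular_integral_def case_prod_beta')

text \<open>The angular variables enter only through the angular integral, so the derivative of the
  Hamiltonian follows from that of the latter.\<close>

lemma hamiltonian_eq:
  "hamiltonian \<kappa> a b n = (\<lambda>x. 1 / 2 * (fst (snd (snd x)))\<^sup>2 +
     1 / (S_kappa \<kappa> (fst x))\<^sup>2 * angular_integral a b n x)"
  by (simp add: hamiltonian_def angular_integral_def case_prod_beta' fun_eq_iff algebra_simps add_divide_distrib)

lemma phase_space_iff:
  "(r, \<phi>, p, q) \<in> phase_space \<kappa> n \<longleftrightarrow> S_kappa \<kappa> r \<noteq> 0 \<and> sin (n * \<phi>) \<noteq> 0 \<and> cos (n * \<phi>) \<noteq> 0"
  by (auto simp: phase_space_def)

lemma has_dir_deriv_coordinates:
  fixes x :: point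
  shows "has_dir_deriv fst x X (fst X)"
    "has_dir_deriv (\<lambda>x. fst (snd x)) x X (fst (snd X))"
    "has_dir_deriv (\<lambda>x. fst (snd (snd x))) x X (fst (snd (snd X)))"
    "has_dir_deriv (\<lambda>x. snd (snd (snd x))) x X (snd (snd (snd X)))"
  by (intro has_dir_deriv_linear bounded_linear_intros)+

lemma has_dir_deriv_angular_integral:
  assumes "(r, \<phi>, p, q) \<in> phase_space \<kappa> n"
  shows "has_dir_deriv (angular_integral a b n) (r, \<phi>, p, q) (x1, x2, x3, x4)
    (potential_deriv a b n \<phi> * x2 + q * x4)"
proof -
  have "has_dir_deriv (\<lambda>x :: point. potential a b n (fst (snd x))) (r, \<phi>, p, q) (x1, x2, x3, x4)
      (potential_deriv a b n \<phi> * x2)"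
    using has_dir_deriv_comp[OF _ has_dir_deriv_coordinates(2), of "potential a b n"
        "potential_deriv a b n \<phi>" "(r, \<phi>, p, q)" "(x1, x2, x3, x4)"]
      potential_has_deriv assms by (auto simp: phase_space_iff)
  moreover have "has_dir_deriv (\<lambda>x :: point. 1 / 2 * (snd (snd (snd x)))\<^sup>2) (r, \<phi>, p, q) (x1, x2, x3, x4)
      (q * x4)"
  proof (rule has_dir_deriv_eq[OF has_dir_deriv_comp[OF _ has_dir_deriv_coordinates(4)]])
    show "((\<lambda>t. 1 / 2 * t\<^sup>2) has_real_derivative q) (at (snd (snd (snd (r, \<phi>, p, q)))))"
      by (auto intro!: derivative_eq_intros)
  qed simp
  ultimately show ?thesis
    unfolding angular_integral_eq using has_dir_deriv_add by (fastforce simp: add.commute)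
qed

lemma has_dir_deriv_hamiltonian:
  assumes "(r, \<phi>, p, q) \<in> phase_space \<kappa> n"
  shows "has_dir_deriv (hamiltonian \<kappa> a b n) (r, \<phi>, p, q) (x1, x2, x3, x4)
    (p * x3 + (1 / (S_kappa \<kappa> r)\<^sup>2 * (potential_deriv a b n \<phi> * x2 + q * x4) -
      2 * C_kappa \<kappa> r / (S_kappa \<kappa> r) ^ 3 * x1 * angular_integral a b n (r, \<phi>, p, q)))"
proof -
  have "has_dir_deriv (\<lambda>x :: point. 1 / (S_kappa \<kappa> (fst x))\<^sup>2) (r, \<phi>, p, q) (x1, x2, x3, x4)
      (- (2 * C_kappa \<kappa> r / (S_kappa \<kappa> r) ^ 3) * x1)"
    using has_dir_deriv_comp[OF _ has_dir_deriv_coordinates(1), of "\<lambda>r. 1 / (S_kappa \<kappa> r)\<^sup>2"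
        "- (2 * C_kappa \<kappa> r / (S_kappa \<kappa> r) ^ 3)" "(r, \<phi>, p, q)" "(x1, x2, x3, x4)"]
      inverse_S_kappa_squared_deriv assms by (auto simp: phase_space_iff)
  note has_dir_deriv_mult[OF this has_dir_deriv_angular_integral[OF assms, of a b]]
  moreover have "has_dir_deriv (\<lambda>x :: point. 1 / 2 * (fst (snd (snd x)))\<^sup>2) (r, \<phi>, p, q) (x1, x2, x3, x4)
      (p * x3)"
  proof (rule has_dir_deriv_eq[OF has_dir_deriv_comp[OF _ has_dir_deriv_coordinates(3)]])
    show "((\<lambda>t. 1 / 2 * t\<^sup>2) has_real_derivative p) (at (fst (snd (snd (r, \<phi>, p, q)))))"
      by (auto intro!: derivative_eq_intros)
  qed simp
  ultimately show ?thesis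
    unfolding hamiltonian_eq
    by (intro has_dir_deriv_eq[OF has_dir_deriv_add]) auto
qed

text \<open>\<open>(g3, g4, - g1, - g2)\<close> is the Hamiltonian vector field of \<open>g\<close>;
  linearity of the derivative turns the bracket into a derivative along it.\<close>

lemma poisson_eq_dir_deriv:
  assumes "has_dir_deriv g x (1, 0, 0, 0) g1" "has_dir_deriv g x (0, 1, 0, 0) g2"
    "has_dir_deriv g x (0, 0, 1, 0) g3" "has_dir_deriv g x (0, 0, 0, 1) g4"
    "has_dir_deriv F x (g3, g4, - g1, - g2) d"
  shows "poisson F g x = d"
proof -
  let ?L = "frechet_derivative F (at x)"
  have "linear ?L"
    using assms(5) by (simp add: has_dir_deriv_differentiable linear_frechet_derivative)
  moreover have "(g3, g4, - g1, - g2) = g3 *\<^sub>R (1, 0, 0, 0) + g4 *\<^sub>R (0, 1, 0, 0) +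
      (- g1) *\<^sub>R (0, 0, 1, 0) + (- g2) *\<^sub>R (0, 0, 0, 1)"
    by simp
  ultimately have "?L (g3, g4, - g1, - g2) = g3 * ?L (1, 0, 0, 0) + g4 * ?L (0, 1, 0, 0) +
      - g1 * ?L (0, 0, 1, 0) + - g2 * ?L (0, 0, 0, 1)"
    by (simp only: linear_add linear_scale real_scaleR_def)
  then show ?thesis
    using assms[THEN has_dir_deriv_frechet]
    by (simp add: poisson_def Let_def mult.commute)
qed

lemma poisson_antisym: "poisson f g x = - poisson g f x"
  by (simp add: poisson_def Let_def mult.commute)

lemma poisson_hamiltonian:
  assumes "(r, \<phi>, p, q) \<in> phase_space \<kappa> n"
    and "has_dir_deriv F (r, \<phi>, p, q) (p, q / (S_kappa \<kappa> r)\<^sup>2,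
      2 * C_kappa \<kappa> r / (S_kappa \<kappa> r) ^ 3 * angular_integral a b n (r, \<phi>, p, q),
      - (potential_deriv a b n \<phi> / (S_kappa \<kappa> r)\<^sup>2)) d"
  shows "poisson F (hamiltonian \<kappa> a b n) (r, \<phi>, p, q) = d"
  by (rule poisson_eq_dir_deriv[OF has_dir_deriv_hamiltonian[OF assms(1)]
      has_dir_deriv_hamiltonian[OF assms(1)] has_dir_deriv_hamiltonian[OF assms(1)]
      has_dir_deriv_hamiltonian[OF assms(1)]]) (use assms(2) in simp)

lemma open_phase_space: "open (phase_space \<kappa> n)"
proof -
  have S: "continuous_on UNIV (S_kappa \<kappa>)"
    by (intro continuous_at_imp_continuous_on ballI DERIV_isCont[OF S_kappa_deriv])
  have "phase_space \<kappa> n = {x. S_kappa \<kappa> (fst x) \<noteq> 0} \<inter>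
      {x. sin (n * fst (snd x)) * cos (n * fst (snd x)) \<noteq> 0}"
    by (auto simp: phase_space_def)
  moreover have "open {x :: point. S_kappa \<kappa> (fst x) \<noteq> 0}"
    by (intro open_Collect_neq continuous_on_compose2[OF S] continuous_intros) auto
  moreover have "open {x :: point. sin (n * fst (snd x)) * cos (n * fst (snd x)) \<noteq> 0}"
    by (intro open_Collect_neq continuous_intros)
  ultimately show ?thesis by (simp add: open_Int)
qed

section \<open>Two rotating phases\<close>

definition w_re :: "real \<Rightarrow> real \<Rightarrow> real \<Rightarrow> point \<Rightarrow> real" where
  "w_re a b n x = angular_integral a b n x * cos (2 * n * fst (snd x)) + (b - a)"

text \<open>The division by 2 fits the normalisation in which the square of \<open>s\<close> is
  minus twice the angular integral.\<close>

definition w_im :: "real \<Rightarrow> point \<Rightarrow> real" where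
  "w_im n x = snd (snd (snd x)) * (sin (2 * n * fst (snd x)) / 2)"

text \<open>The factor \<mu> covers two flows: 1 is the flow of the Hamiltonian, 0 that of the
  angular integral. \<open>x2\<close> and \<open>x4\<close> are arbitrary because the radial pair
  involves only the radial coordinate and its momentum.\<close>

lemma has_dir_deriv_radial:
  assumes M: "(r, \<phi>, p, q) \<in> phase_space \<kappa> n"
    and X: "X = (\<mu> * p, x2, \<mu> * (2 * C_kappa \<kappa> r / (S_kappa \<kappa> r) ^ 3 * angular_integral a b n (r, \<phi>, p, q)), x4)"
  shows "has_dir_deriv (\<lambda>x. fst (snd (snd x))) (r, \<phi>, p, q) X
      (- (\<mu> / (S_kappa \<kappa> r)\<^sup>2) * (2 * angular_integral a b n (r, \<phi>, p, q)) * - cot_kappa \<kappa> r)"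
    and "has_dir_deriv (\<lambda>x. - cot_kappa \<kappa> (fst x)) (r, \<phi>, p, q) X (\<mu> / (S_kappa \<kappa> r)\<^sup>2 * p)"
proof -
  have S: "S_kappa \<kappa> r \<noteq> 0" using M by (simp add: phase_space_iff)
  then show "has_dir_deriv (\<lambda>x. fst (snd (snd x))) (r, \<phi>, p, q) X
      (- (\<mu> / (S_kappa \<kappa> r)\<^sup>2) * (2 * angular_integral a b n (r, \<phi>, p, q)) * - cot_kappa \<kappa> r)"
    by (intro has_dir_deriv_eq[OF has_dir_deriv_coordinates(3)])
      (simp add: X cot_kappa_def power2_eq_square power3_eq_cube)
  show "has_dir_deriv (\<lambda>x. - cot_kappa \<kappa> (fst x)) (r, \<phi>, p, q) X (\<mu> / (S_kappa \<kappa> r)\<^sup>2 * p)"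
  proof (rule has_dir_deriv_eq[OF has_dir_deriv_comp[OF _ has_dir_deriv_coordinates(1)]])
    show "((\<lambda>r. - cot_kappa \<kappa> r) has_real_derivative 1 / (S_kappa \<kappa> r)\<^sup>2) (at (fst (r, \<phi>, p, q)))"
      using DERIV_minus[OF cot_kappa_deriv[OF S]] by simp
  qed (simp add: X)
qed

text \<open>Here \<nu> is \<open>1 / (S_kappa \<kappa> r)\<^sup>2\<close> for the flow of the
  Hamiltonian and 1 for that of the angular integral. As the latter is constant along
  \<open>X\<close>, \<open>w_re\<close> varies only through the cosine; the rotation of
  \<open>w_im\<close> rests on an identity special to this potential.\<close>

lemma has_dir_deriv_w:
  assumes M: "(r, \<phi>, p, q) \<in> phase_space \<kappa> n"
    and X: "X = (x1, \<nu> * q, x3, - (\<nu> * potential_deriv a b n \<phi>))"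
  shows "has_dir_deriv (angular_integral a b n) (r, \<phi>, p, q) X 0"
    and "has_dir_deriv (w_re a b n) (r, \<phi>, p, q) X
      (- (2 * n * \<nu>) * (2 * angular_integral a b n (r, \<phi>, p, q)) * w_im n (r, \<phi>, p, q))"
    and "has_dir_deriv (w_im n) (r, \<phi>, p, q) X (2 * n * \<nu> * w_re a b n (r, \<phi>, p, q))"
proof -
  let ?x = "(r, \<phi>, p, q)" and ?G = "angular_integral a b n (r, \<phi>, p, q)"
  show G: "has_dir_deriv (angular_integral a b n) ?x X 0"
    unfolding X by (rule has_dir_deriv_eq[OF has_dir_deriv_angular_integral[OF M]]) simp
  have cos: "has_dir_deriv (\<lambda>x. cos (2 * n * fst (snd x))) ?x X (- sin (2 * n * \<phi>) * (2 * n) * (\<nu> * q))"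
  proof (rule has_dir_deriv_eq[OF has_dir_deriv_comp[OF _ has_dir_deriv_coordinates(2)]])
    show "((\<lambda>\<phi>. cos (2 * n * \<phi>)) has_real_derivative - sin (2 * n * \<phi>) * (2 * n)) (at (fst (snd ?x)))"
      by (auto intro!: derivative_eq_intros)
  qed (simp add: X)
  have sin: "has_dir_deriv (\<lambda>x. sin (2 * n * fst (snd x)) / 2) ?x X (cos (2 * n * \<phi>) * n * (\<nu> * q))"
  proof (rule has_dir_deriv_eq[OF has_dir_deriv_comp[OF _ has_dir_deriv_coordinates(2)]])
    show "((\<lambda>\<phi>. sin (2 * n * \<phi>) / 2) has_real_derivative cos (2 * n * \<phi>) * n) (at (fst (snd ?x)))"
      by (auto intro!: derivative_eq_intros)
  qed (simp add: X)
  show "has_dir_deriv (w_re a b n) ?x X (- (2 * n * \<nu>) * (2 * ?G) * w_im n ?x)"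
    unfolding w_re_def[abs_def]
    by (rule has_dir_deriv_eq[OF has_dir_deriv_add[OF has_dir_deriv_mult[OF G cos] has_dir_deriv_const]])
      (simp add: w_im_def)
  define s c where "s = sin (n * \<phi>)" and "c = cos (n * \<phi>)"
  have sc: "s \<noteq> 0" "c \<noteq> 0" using M by (auto simp: phase_space_iff s_def c_def)
  have c2: "c\<^sup>2 = 1 - s\<^sup>2" by (simp add: s_def c_def cos_squared_eq)
  have double: "sin (2 * n * \<phi>) = 2 * s * c" "cos (2 * n * \<phi>) = c\<^sup>2 - s\<^sup>2"
    using sin_double[of "n * \<phi>"] cos_double[of "n * \<phi>"] by (simp_all add: s_def c_def mult.assoc)
  have U: "potential_deriv a b n \<phi> = 2 * n * a * s / c ^ 3 - 2 * n * b * c / s ^ 3"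
    by (simp add: potential_deriv_def s_def c_def)
  \<comment> \<open>Trading \<open>s\<^sup>2 / c\<^sup>2\<close> and its reciprocal for
    \<open>1 / c\<^sup>2\<close> and \<open>1 / s\<^sup>2\<close> gives this product and
    \<open>?G * cos (2 * n * \<phi>)\<close> a common form, in which the identity for
    \<open>w_im\<close> is plain algebra.\<close>
  have "potential_deriv a b n \<phi> * (s * c) = 2 * n * a * (s\<^sup>2 / c\<^sup>2) - 2 * n * b * (c\<^sup>2 / s\<^sup>2)"
    using sc by (simp add: U field_simps power2_eq_square power3_eq_cube)
  also have "s\<^sup>2 / c\<^sup>2 = 1 / c\<^sup>2 - 1" using sc c2 by (simp add: field_simps)
  also have "c\<^sup>2 / s\<^sup>2 = 1 / s\<^sup>2 - 1" using sc c2 by (simp add: field_simps)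
  finally have U': "potential_deriv a b n \<phi> * (s * c) =
      2 * n * a * (1 / c\<^sup>2 - 1) - 2 * n * b * (1 / s\<^sup>2 - 1)" .
  have G_eq: "?G = 1 / 2 * q\<^sup>2 + (a / c\<^sup>2 + b / s\<^sup>2)"
    by (simp add: angular_integral_def potential_def s_def c_def)
  have "?G * cos (2 * n * \<phi>) = 1 / 2 * q\<^sup>2 * cos (2 * n * \<phi>) +
      a * (cos (2 * n * \<phi>) / c\<^sup>2) + b * (cos (2 * n * \<phi>) / s\<^sup>2)"
    by (simp add: G_eq algebra_simps)
  also have "cos (2 * n * \<phi>) / c\<^sup>2 = 2 - 1 / c\<^sup>2"
    unfolding double(2) using sc c2 by (simp add: field_simps)
  also have "cos (2 * n * \<phi>) / s\<^sup>2 = 1 / s\<^sup>2 - 2"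
    unfolding double(2) using sc c2 by (simp add: field_simps)
  finally have Gcos: "?G * cos (2 * n * \<phi>) =
      1 / 2 * q\<^sup>2 * cos (2 * n * \<phi>) + a * (2 - 1 / c\<^sup>2) + b * (1 / s\<^sup>2 - 2)" .
  show "has_dir_deriv (w_im n) ?x X (2 * n * \<nu> * w_re a b n ?x)"
    unfolding w_im_def[abs_def]
  proof (rule has_dir_deriv_eq[OF has_dir_deriv_mult[OF has_dir_deriv_coordinates(4) sin]])
    have "- (\<nu> * potential_deriv a b n \<phi>) * (sin (2 * n * \<phi>) / 2) = - \<nu> * (potential_deriv a b n \<phi> * (s * c))"
      by (simp add: double)
    then show "snd (snd (snd ?x)) * (cos (2 * n * \<phi>) * n * (\<nu> * q)) +
        snd (snd (snd X)) * (sin (2 * n * fst (snd ?x)) / 2) = 2 * n * \<nu> * w_re a b n ?x"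
      unfolding w_re_def X fst_conv snd_conv Gcos U' by (simp add: algebra_simps power2_eq_square)
  qed
qed

text \<open>Eliminating \<open>q\<^sup>2\<close> through the angular integral and
  \<open>c\<^sup>2\<close> through \<open>1 - s\<^sup>2\<close> leaves a polynomial identity in
  which \<open>s\<close> cancels. The norm therefore vanishes for at most two values of
  \<open>G\<close>.\<close>

lemma w_norm:
  fixes a b :: real
  assumes "(r, \<phi>, p, q) \<in> phase_space \<kappa> n"
  defines "G \<equiv> angular_integral a b n (r, \<phi>, p, q)"
  shows "(w_re a b n (r, \<phi>, p, q))\<^sup>2 + 2 * G * (w_im n (r, \<phi>, p, q))\<^sup>2 = (G - a - b)\<^sup>2 - 4 * a * b"
proof -
  define s c where "s = sin (n * \<phi>)" and "c = cos (n * \<phi>)"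
  have sc: "s \<noteq> 0" "c \<noteq> 0" using assms(1) by (auto simp: phase_space_iff s_def c_def)
  have c2: "c\<^sup>2 = 1 - s\<^sup>2" by (simp add: s_def c_def cos_squared_eq)
  have double: "sin (2 * n * \<phi>) = 2 * s * c" "cos (2 * n * \<phi>) = c\<^sup>2 - s\<^sup>2"
    using sin_double[of "n * \<phi>"] cos_double[of "n * \<phi>"] by (simp_all add: s_def c_def mult.assoc)
  have "G = 1 / 2 * q\<^sup>2 + (a / c\<^sup>2 + b / s\<^sup>2)"
    by (simp add: G_def angular_integral_def potential_def s_def c_def)
  then have "q\<^sup>2 * (s\<^sup>2 * c\<^sup>2) = 2 * G * (s\<^sup>2 * c\<^sup>2) - 2 * a * s\<^sup>2 - 2 * b * c\<^sup>2"
    using sc by (simp add: field_simps)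
  moreover have "(w_im n (r, \<phi>, p, q))\<^sup>2 = q\<^sup>2 * (s\<^sup>2 * c\<^sup>2)"
    by (simp add: w_im_def double power2_eq_square)
  moreover have "w_re a b n (r, \<phi>, p, q) = G * (c\<^sup>2 - s\<^sup>2) + (b - a)"
    by (simp add: w_re_def G_def double)
  ultimately show ?thesis
    by (simp only: c2) (simp add: power2_eq_square algebra_simps)
qed

text \<open>The components of \<open>(p_r - s C/S) ^ k * cnj (w) ^ l\<close>, where \<open>cnj\<close> negates \<open>s\<close>.\<close>

definition phase_re :: "real \<Rightarrow> real \<Rightarrow> real \<Rightarrow> real \<Rightarrow> nat \<Rightarrow> nat \<Rightarrow> point \<Rightarrow> real" where
  "phase_re \<kappa> a b n k l x = (let D = 2 * angular_integral a b n x in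
     qpow_re D (fst (snd (snd x))) (- cot_kappa \<kappa> (fst x)) k * qpow_re D (w_re a b n x) (w_im n x) l +
     D * (qpow_im D (fst (snd (snd x))) (- cot_kappa \<kappa> (fst x)) k * qpow_im D (w_re a b n x) (w_im n x) l))"

definition phase_im :: "real \<Rightarrow> real \<Rightarrow> real \<Rightarrow> real \<Rightarrow> nat \<Rightarrow> nat \<Rightarrow> point \<Rightarrow> real" where
  "phase_im \<kappa> a b n k l x = (let D = 2 * angular_integral a b n x in
     qpow_re D (fst (snd (snd x))) (- cot_kappa \<kappa> (fst x)) k * qpow_im D (w_re a b n x) (w_im n x) l -
     qpow_im D (fst (snd (snd x))) (- cot_kappa \<kappa> (fst x)) k * qpow_re D (w_re a b n x) (w_im n x) l)"

text \<open>Norms multiply and conjugation preserves them.\<close>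

lemma phase_norm:
  fixes a b :: real
  assumes "(r, \<phi>, p, q) \<in> phase_space \<kappa> n"
  defines "G \<equiv> angular_integral a b n (r, \<phi>, p, q)"
  shows "(phase_re \<kappa> a b n k l (r, \<phi>, p, q))\<^sup>2 + 2 * G * (phase_im \<kappa> a b n k l (r, \<phi>, p, q))\<^sup>2 =
    (p\<^sup>2 + 2 * G * (cot_kappa \<kappa> r)\<^sup>2) ^ k * ((G - a - b)\<^sup>2 - 4 * a * b) ^ l"
proof -
  have "(R * A + D * (S * B))\<^sup>2 + D * (R * B - S * A)\<^sup>2 = (R\<^sup>2 + D * S\<^sup>2) * (A\<^sup>2 + D * B\<^sup>2)"
    for R S A B D :: real by (simp add: power2_eq_square algebra_simps)
  then show ?thesis
    unfolding phase_re_def phase_im_def Let_def G_def[symmetric]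
    by (simp only: qpow_norm w_norm[OF assms(1), where a = a and b = b, folded G_def] fst_conv snd_conv power2_minus)
qed

text \<open>Conjugating \<open>w\<close> makes the frequencies subtract; \<open>phase_im\<close> is
  the component at \<open>s\<close> with the opposite sign, so \<omega> is the angular minus the
  radial frequency. Along the Hamiltonian flow they cancel if \<open>k = 2 * n * l\<close>; along
  the flow of the angular integral the radial one is zero.\<close>

lemma has_dir_deriv_phase:
  assumes M: "(r, \<phi>, p, q) \<in> phase_space \<kappa> n"
    and X: "X = (\<mu> * p, \<nu> * q, \<mu> * (2 * C_kappa \<kappa> r / (S_kappa \<kappa> r) ^ 3 * angular_integral a b n (r, \<phi>, p, q)),
      - (\<nu> * potential_deriv a b n \<phi>))"
    and \<omega>: "\<omega> = real l * (2 * n * \<nu>) - real k * (\<mu> / (S_kappa \<kappa> r)\<^sup>2)"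
  shows "has_dir_deriv (phase_im \<kappa> a b n k l) (r, \<phi>, p, q) X (\<omega> * phase_re \<kappa> a b n k l (r, \<phi>, p, q))"
    and "has_dir_deriv (phase_re \<kappa> a b n k l) (r, \<phi>, p, q) X
      (- \<omega> * (2 * angular_integral a b n (r, \<phi>, p, q)) * phase_im \<kappa> a b n k l (r, \<phi>, p, q))"
proof -
  note w = has_dir_deriv_w[OF M X]
  have D: "has_dir_deriv (\<lambda>x. 2 * angular_integral a b n x) (r, \<phi>, p, q) X 0"
    by (rule has_dir_deriv_eq[OF has_dir_deriv_mult[OF has_dir_deriv_const w(1)]]) simp
  note radial = has_dir_deriv_radial[OF M X]
  note z = has_dir_deriv_qpow[where D = "\<lambda>x. 2 * angular_integral a b n x" and u = "\<lambda>x :: point. fst (snd (snd x))"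
      and v = "\<lambda>x. - cot_kappa \<kappa> (fst x)" and \<omega> = "\<mu> / (S_kappa \<kappa> r)\<^sup>2" and k = k and x = "(r, \<phi>, p, q)" and X = X,
      unfolded fst_conv snd_conv, OF D radial]
  note w' = has_dir_deriv_qpow[where D = "\<lambda>x. 2 * angular_integral a b n x" and u = "w_re a b n"
      and v = "w_im n" and \<omega> = "2 * n * \<nu>" and k = l, OF D w(2,3)]
  show "has_dir_deriv (phase_im \<kappa> a b n k l) (r, \<phi>, p, q) X (\<omega> * phase_re \<kappa> a b n k l (r, \<phi>, p, q))"
    unfolding phase_im_def[abs_def] Let_def
    by (rule has_dir_deriv_eq[OF has_dir_deriv_diff[OF has_dir_deriv_mult[OF z(1) w'(2)]
            has_dir_deriv_mult[OF z(2) w'(1)]]])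
      (simp add: phase_re_def Let_def \<omega> algebra_simps)
  show "has_dir_deriv (phase_re \<kappa> a b n k l) (r, \<phi>, p, q) X
      (- \<omega> * (2 * angular_integral a b n (r, \<phi>, p, q)) * phase_im \<kappa> a b n k l (r, \<phi>, p, q))"
    unfolding phase_re_def[abs_def] Let_def
    by (rule has_dir_deriv_eq[OF has_dir_deriv_add[OF has_dir_deriv_mult[OF z(1) w'(1)]
            has_dir_deriv_mult[OF D has_dir_deriv_mult[OF z(2) w'(2)]]]])
      (simp add: phase_im_def Let_def \<omega> algebra_simps)
qed

section \<open>First integrals\<close>

lemma momentum_polynomial_qpow:
  assumes "momentum_polynomial A B D" "momentum_polynomial A B u" "momentum_polynomial A B v"
  shows "momentum_polynomial A B (\<lambda>x. qpow_re (D x) (u x) (v x) k)"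
    and "momentum_polynomial A B (\<lambda>x. qpow_im (D x) (u x) (v x) k)"
  by (induction k) (auto intro!: momentum_polynomial_intros assms)

abbreviation phase_space_polynomial :: "real \<Rightarrow> real \<Rightarrow> (point \<Rightarrow> real) \<Rightarrow> bool" where
  "phase_space_polynomial \<kappa> n \<equiv>
     momentum_polynomial {r. S_kappa \<kappa> r \<noteq> 0} {\<phi>. sin (n * \<phi>) \<noteq> 0 \<and> cos (n * \<phi>) \<noteq> 0}"

lemma phase_space_polynomial_imp_real_analytic_on:
  "phase_space_polynomial \<kappa> n F \<Longrightarrow> real_analytic_on F (phase_space \<kappa> n)"
  by (erule momentum_polynomial_imp_real_analytic_on) (auto simp: phase_space_def)

lemma phase_space_polynomial_angular_integral:
  "phase_space_polynomial \<kappa> n (angular_integral a b n)"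
  unfolding angular_integral_eq
  by (intro momentum_polynomial_intros momentum_polynomial_\<phi>)
    (simp add: holomorphic_extension_at_potential)

lemma phase_space_polynomial_hamiltonian:
  "phase_space_polynomial \<kappa> n (hamiltonian \<kappa> a b n)"
  unfolding hamiltonian_eq
  by (intro momentum_polynomial_intros phase_space_polynomial_angular_integral
      momentum_polynomial_r[of _ "\<lambda>r. 1 / (S_kappa \<kappa> r)\<^sup>2"])
    (simp add: holomorphic_extension_at_inverse_S_kappa_squared)

lemma phase_space_polynomial_phase:
  "phase_space_polynomial \<kappa> n (phase_re \<kappa> a b n k l)"
  "phase_space_polynomial \<kappa> n (phase_im \<kappa> a b n k l)"
proof -
  have cot: "phase_space_polynomial \<kappa> n (\<lambda>x. - cot_kappa \<kappa> (fst x))"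
    by (rule momentum_polynomial_r[of _ "\<lambda>r. - cot_kappa \<kappa> r"])
      (use holomorphic_extension_at_mult[OF holomorphic_extension_at_const[of "- 1"]
          holomorphic_extension_at_cot_kappa] in simp)
  have re: "phase_space_polynomial \<kappa> n (w_re a b n)"
    unfolding w_re_def[abs_def]
    by (intro momentum_polynomial_intros phase_space_polynomial_angular_integral
      momentum_polynomial_\<phi>[of _ "\<lambda>\<phi>. cos (2 * n * \<phi>)"] holomorphic_extension_at_cos)
  have im: "phase_space_polynomial \<kappa> n (w_im n)"
    unfolding w_im_def[abs_def] divide_inverse
    by (intro momentum_polynomial_intros
      momentum_polynomial_\<phi>[of _ "\<lambda>\<phi>. sin (2 * n * \<phi>)"] holomorphic_extension_at_sin)
  show "phase_space_polynomial \<kappa> n (phase_re \<kappa> a b n k l)"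
    "phase_space_polynomial \<kappa> n (phase_im \<kappa> a b n k l)"
    unfolding phase_re_def[abs_def] phase_im_def[abs_def] Let_def
    by (intro momentum_polynomial_intros momentum_polynomial_qpow
        phase_space_polynomial_angular_integral cot re im)+
qed

text \<open>The vector is the Hamiltonian field, kept in the unsimplified shape with \<mu> = 1 and
  \<nu> = \<open>1 / (S_kappa \<kappa> r)\<^sup>2\<close> so that the rotation lemmas apply by
  \<open>refl\<close>.\<close>

lemma first_integral_hamiltonianI:
  assumes "phase_space_polynomial \<kappa> n F"
    and "\<And>r \<phi> p q. (r, \<phi>, p, q) \<in> phase_space \<kappa> n \<Longrightarrow>
      has_dir_deriv F (r, \<phi>, p, q) (1 * p, 1 / (S_kappa \<kappa> r)\<^sup>2 * q,
        1 * (2 * C_kappa \<kappa> r / (S_kappa \<kappa> r) ^ 3 * angular_integral a b n (r, \<phi>, p, q)),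
        - (1 / (S_kappa \<kappa> r)\<^sup>2 * potential_deriv a b n \<phi>)) 0"
  shows "first_integral (phase_space \<kappa> n) (hamiltonian \<kappa> a b n) F"
  unfolding first_integral_def poisson_commute_def
proof (intro conjI ballI)
  fix x assume "x \<in> phase_space \<kappa> n"
  then show "poisson F (hamiltonian \<kappa> a b n) x = 0"
    using poisson_hamiltonian assms(2) by (cases x) fastforce
qed (rule phase_space_polynomial_imp_real_analytic_on[OF assms(1)])

lemma first_integral_hamiltonian:
  "first_integral (phase_space \<kappa> n) (hamiltonian \<kappa> a b n) (hamiltonian \<kappa> a b n)"
  using phase_space_polynomial_imp_real_analytic_on[OF phase_space_polynomial_hamiltonian]
  by (simp add: first_integral_def poisson_commute_def poisson_def Let_def mult.commute)

lemma first_integral_angular_integral: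
  "first_integral (phase_space \<kappa> n) (hamiltonian \<kappa> a b n) (angular_integral a b n)"
  using has_dir_deriv_w(1)
  by (blast intro: first_integral_hamiltonianI phase_space_polynomial_angular_integral)

text \<open>The hypothesis is the resonance under which the two frequencies cancel along the
  Hamiltonian flow.\<close>

lemma first_integral_phase_im:
  assumes "real k = 2 * n * real l"
  shows "first_integral (phase_space \<kappa> n) (hamiltonian \<kappa> a b n) (phase_im \<kappa> a b n k l)"
proof (rule first_integral_hamiltonianI[OF phase_space_polynomial_phase(2)])
  fix r \<phi> p q assume M: "(r, \<phi>, p, q) \<in> phase_space \<kappa> n"
  have "0 = real l * (2 * n * (1 / (S_kappa \<kappa> r)\<^sup>2)) - real k * (1 / (S_kappa \<kappa> r)\<^sup>2)"
    using assms by simp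
  from has_dir_deriv_phase(1)[OF M refl this]
  show "has_dir_deriv (phase_im \<kappa> a b n k l) (r, \<phi>, p, q) (1 * p, 1 / (S_kappa \<kappa> r)\<^sup>2 * q,
      1 * (2 * C_kappa \<kappa> r / (S_kappa \<kappa> r) ^ 3 * angular_integral a b n (r, \<phi>, p, q)),
      - (1 / (S_kappa \<kappa> r)\<^sup>2 * potential_deriv a b n \<phi>)) 0"
    by simp
qed

section \<open>Density of the regular points and functional independence\<close>

lemma finite_squares_eq: "finite {t :: real. t\<^sup>2 = c}"
proof (rule finite_subset)
  show "{t :: real. t\<^sup>2 = c} \<subseteq> {sqrt c, - sqrt c}"
    by (auto simp: real_sqrt_abs)
qed simp

lemma open_avoid_finite:
  fixes A :: "real set"
  assumes "open A" "t \<in> A" "finite B"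
  shows "\<exists>t'\<in>A. t' \<notin> B"
  using assms finite_imp_not_open[of A] finite_subset[of A B] by blast

text \<open>Moving first the angular and then the radial momentum, each time off a finite set, leads
  to a nearby point of non-zero norm. If the claim failed, \<open>phase_re\<close> would vanish
  around that point, and so would its derivative along the flow of the angular integral, a non-zero
  multiple of \<open>phase_im\<close>.\<close>

lemma phase_re_nonzero_dense:
  assumes kl: "real k = 2 * n * real l" "k > 0"
    and x: "x \<in> phase_space \<kappa> n" and N: "open N" "x \<in> N"
  shows "\<exists>(r, \<phi>, p, q) \<in> N \<inter> phase_space \<kappa> n.
    p \<noteq> 0 \<and> q \<noteq> 0 \<and> phase_re \<kappa> a b n k l (r, \<phi>, p, q) \<noteq> 0"
proof (rule ccontr)
  let ?K = "phase_re \<kappa> a b n k l" and ?G = "angular_integral a b n"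
  assume neg: "\<not> ?thesis"
  obtain r \<phi> p0 q0 where x_eq: "x = (r, \<phi>, p0, q0)" by (cases x)
  define V where "V = N \<inter> phase_space \<kappa> n"
  have V: "open V" "(r, \<phi>, p0, q0) \<in> V"
    using N x open_phase_space by (auto simp: V_def x_eq)
  define U where "U = potential a b n \<phi>"
  \<comment> \<open>Excluded are \<open>q = 0\<close>, a vanishing angular integral, and the roots
    of \<open>(G - a - b)\<^sup>2 = 4 * a * b\<close>; each is a condition on
    \<open>q\<^sup>2\<close>.\<close>
  define B where "B = {q. q\<^sup>2 = 0} \<union> {q. q\<^sup>2 = - 2 * U} \<union>
    ({q. q\<^sup>2 = 2 * (a + b + sqrt (4 * a * b)) - 2 * U} \<union> {q. q\<^sup>2 = 2 * (a + b - sqrt (4 * a * b)) - 2 * U})"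
  have "open ((\<lambda>q. (r, \<phi>, p0, q)) -` V)"
    by (intro open_vimage V continuous_intros)
  moreover have "q0 \<in> (\<lambda>q. (r, \<phi>, p0, q)) -` V" using V by simp
  moreover have "finite B" unfolding B_def by (intro finite_UnI finite_squares_eq)
  ultimately have "\<exists>t\<in>(\<lambda>q. (r, \<phi>, p0, q)) -` V. t \<notin> B"
    by (rule open_avoid_finite)
  then obtain q where q: "(r, \<phi>, p0, q) \<in> V" "q \<notin> B" by blast
  define G where "G = 1 / 2 * q\<^sup>2 + U"
  have G_eq: "?G (r, \<phi>, p, q) = G" for p by (simp add: angular_integral_def G_def U_def)
  have "G \<noteq> 0" "q \<noteq> 0" using q(2) by (auto simp: B_def G_def)
  have "(G - a - b)\<^sup>2 \<noteq> 4 * a * b"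
  proof
    assume "(G - a - b)\<^sup>2 = 4 * a * b"
    then have "\<bar>G - a - b\<bar> = sqrt (4 * a * b)" by (metis real_sqrt_abs)
    then show False using q(2) by (auto simp: B_def G_def abs_if split: if_splits)
  qed
  \<comment> \<open>With \<open>q\<close> fixed, \<open>G\<close> does not depend on
    \<open>p\<close>, so the radial norm vanishes for at most two values of
    \<open>p\<close>.\<close>
  define B' where "B' = {p. p\<^sup>2 = 0} \<union> {p. p\<^sup>2 = - (2 * G * (cot_kappa \<kappa> r)\<^sup>2)}"
  have "open ((\<lambda>p. (r, \<phi>, p, q)) -` V)"
    by (intro open_vimage V continuous_intros)
  moreover have "p0 \<in> (\<lambda>p. (r, \<phi>, p, q)) -` V" using q by simp
  moreover have "finite B'" unfolding B'_def by (intro finite_UnI finite_squares_eq)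
  ultimately have "\<exists>t\<in>(\<lambda>p. (r, \<phi>, p, q)) -` V. t \<notin> B'"
    by (rule open_avoid_finite)
  then obtain p where p: "(r, \<phi>, p, q) \<in> V" "p \<notin> B'" by blast
  have "p \<noteq> 0" "p\<^sup>2 + 2 * G * (cot_kappa \<kappa> r)\<^sup>2 \<noteq> 0"
    using p(2) by (auto simp: B'_def add_eq_0_iff)
  have M: "(r, \<phi>, p, q) \<in> phase_space \<kappa> n" using p(1) by (simp add: V_def)
  \<comment> \<open>Both momenta are non-zero on \<open>W\<close>, so the negated claim forces
    \<open>phase_re\<close> to vanish throughout.\<close>
  define W where "W = V \<inter> {y. fst (snd (snd y)) \<noteq> 0} \<inter> {y. snd (snd (snd y)) \<noteq> 0}"
  have W: "open W" "(r, \<phi>, p, q) \<in> W"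
    unfolding W_def using V(1) p(1) \<open>p \<noteq> 0\<close> \<open>q \<noteq> 0\<close>
    by (auto intro!: open_Int open_Collect_neq continuous_intros)
  have zero: "?K y = 0" if "y \<in> W" for y
    using neg that unfolding W_def V_def by (cases y) auto
  \<comment> \<open>The Hamiltonian field of the angular integral, in the shape \<mu> = 0, \<nu> =
    1; the frequency along it is \<open>2 * n * l\<close>, which equals \<open>k\<close>.\<close>
  define X where "X = (0 * p, 1 * q, 0 * (2 * C_kappa \<kappa> r / (S_kappa \<kappa> r) ^ 3 * ?G (r, \<phi>, p, q)),
      - (1 * potential_deriv a b n \<phi>))"
  have "has_dir_deriv ?K (r, \<phi>, p, q) X
      (- real k * (2 * ?G (r, \<phi>, p, q)) * phase_im \<kappa> a b n k l (r, \<phi>, p, q))"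
    by (rule has_dir_deriv_phase(2)[OF M X_def]) (simp add: kl)
  moreover have "(?K has_derivative (\<lambda>_. 0)) (at (r, \<phi>, p, q))"
    by (rule has_derivative_transform_within_open[OF has_derivative_const W]) (simp add: zero)
  then have "frechet_derivative ?K (at (r, \<phi>, p, q)) X = 0"
    by (simp flip: frechet_derivative_at)
  ultimately have "phase_im \<kappa> a b n k l (r, \<phi>, p, q) = 0"
    using has_dir_deriv_frechet \<open>G \<noteq> 0\<close> \<open>k > 0\<close> by (fastforce simp: G_eq)
  then have "(p\<^sup>2 + 2 * G * (cot_kappa \<kappa> r)\<^sup>2) ^ k * ((G - a - b)\<^sup>2 - 4 * a * b) ^ l = 0"
    using phase_norm[OF M, of a b k l] zero[OF W(2)] by (simp add: G_eq)
  then show False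
    using \<open>p\<^sup>2 + 2 * G * (cot_kappa \<kappa> r)\<^sup>2 \<noteq> 0\<close> \<open>(G - a - b)\<^sup>2 \<noteq> 4 * a * b\<close> by simp
qed

text \<open>Three test directions give a triangular system: the field of the angular integral
  detects only \<open>phase_im\<close>, the direction of the radial momentum then singles out the
  Hamiltonian, and that of the angular momentum the angular integral. The pivots are non-zero on
  \<open>D\<close> by its choice.\<close>

lemma functionally_independent_phase_im:
  assumes kl: "real k = 2 * n * real l" "k > 0"
  shows "functionally_independent (phase_space \<kappa> n)
    [hamiltonian \<kappa> a b n, angular_integral a b n, phase_im \<kappa> a b n k l]"
proof -
  let ?M = "phase_space \<kappa> n" and ?K = "phase_re \<kappa> a b n k l" and ?G = "angular_integral a b n"
    and ?H = "hamiltonian \<kappa> a b n" and ?F = "phase_im \<kappa> a b n k l"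
  define D where "D = {x \<in> ?M. ?K x \<noteq> 0} \<inter> {y. fst (snd (snd y)) \<noteq> 0} \<inter> {y. snd (snd (snd y)) \<noteq> 0}"
  have "continuous_on ?M ?K"
  proof (intro continuous_at_imp_continuous_on ballI)
    fix x assume "x \<in> ?M"
    then show "isCont ?K x"
      using has_dir_deriv_differentiable[OF has_dir_deriv_phase(2)[OF _ refl refl]]
        differentiable_imp_continuous_within by (cases x) blast
  qed
  then have "open (?M \<inter> ?K -` (- {0}))"
    by (rule continuous_open_preimage) (auto simp: open_phase_space)
  moreover have "?M \<inter> ?K -` (- {0}) = {x \<in> ?M. ?K x \<noteq> 0}" by auto
  ultimately have "open {x \<in> ?M. ?K x \<noteq> 0}" by simp
  then have open_D: "open D"
    unfolding D_def by (intro open_Int open_Collect_neq continuous_intros)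
  have subset: "D \<subseteq> ?M" by (auto simp: D_def)
  have dense: "?M \<subseteq> closure D"
  proof
    fix x assume "x \<in> ?M"
    from phase_re_nonzero_dense[OF kl this]
    show "x \<in> closure D"
      unfolding closure_iff_nhds_not_empty D_def by fastforce
  qed
  have indep: "c i = 0"
    if "x \<in> D" and c: "\<And>v. (\<Sum>i<length [?H, ?G, ?F]. c i * frechet_derivative ([?H, ?G, ?F] ! i) (at x) v) = 0"
      and i: "i < length [?H, ?G, ?F]"
    for x i and c :: "nat \<Rightarrow> real"
  proof -
    obtain r \<phi> p q where x: "x = (r, \<phi>, p, q)" by (cases x)
    then have M: "(r, \<phi>, p, q) \<in> ?M" and nz: "p \<noteq> 0" "q \<noteq> 0" "?K (r, \<phi>, p, q) \<noteq> 0"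
      using that(1) by (auto simp: D_def)
    have sum: "c 0 * dH + c 1 * dG + c 2 * dF = 0"
      if "has_dir_deriv ?H x v dH" "has_dir_deriv ?G x v dG" "has_dir_deriv ?F x v dF" for v dH dG dF
      using c[of v] that[THEN has_dir_deriv_frechet] by (simp add: numeral_2_eq_2 lessThan_Suc add.assoc)
    define X where "X = (0 * p, 1 * q, 0 * (2 * C_kappa \<kappa> r / (S_kappa \<kappa> r) ^ 3 * ?G (r, \<phi>, p, q)),
        - (1 * potential_deriv a b n \<phi>))"
    have F: "has_dir_deriv ?F (r, \<phi>, p, q) X (real k * ?K (r, \<phi>, p, q))"
      by (rule has_dir_deriv_phase(1)[OF M X_def]) (simp add: kl)
    have "has_dir_deriv ?H (r, \<phi>, p, q) X 0" "has_dir_deriv ?G (r, \<phi>, p, q) X 0"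
      unfolding X_def
      by (rule has_dir_deriv_eq[OF has_dir_deriv_hamiltonian[OF M]], simp,
          rule has_dir_deriv_eq[OF has_dir_deriv_angular_integral[OF M]], simp)
    from sum[unfolded x, OF this F] have "c 2 = 0" using nz \<open>k > 0\<close> by simp
    have "?F differentiable (at x)"
      using F has_dir_deriv_differentiable x by blast
    \<comment> \<open>Along the coordinate directions this derivative may stay abstract, since it is
      multiplied by \<open>c 2 = 0\<close>.\<close>
    then have F': "has_dir_deriv ?F x v (frechet_derivative ?F (at x) v)" for v
      unfolding has_dir_deriv_def using frechet_derivative_works by blast
    have "has_dir_deriv ?H x (0, 0, 1, 0) p" "has_dir_deriv ?G x (0, 0, 1, 0) 0"
      unfolding x
      by (rule has_dir_deriv_eq[OF has_dir_deriv_hamiltonian[OF M]], simp,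
          rule has_dir_deriv_eq[OF has_dir_deriv_angular_integral[OF M]], simp)
    from sum[OF this F'] have "c 0 = 0" using nz \<open>c 2 = 0\<close> by simp
    have "has_dir_deriv ?H x (0, 0, 0, 1) (q / (S_kappa \<kappa> r)\<^sup>2)" "has_dir_deriv ?G x (0, 0, 0, 1) q"
      unfolding x
      by (rule has_dir_deriv_eq[OF has_dir_deriv_hamiltonian[OF M]], simp,
          rule has_dir_deriv_eq[OF has_dir_deriv_angular_integral[OF M]], simp)
    from sum[OF this F'] have "c 1 = 0" using nz \<open>c 2 = 0\<close> \<open>c 0 = 0\<close> by simp
    show ?thesis
      using \<open>c 0 = 0\<close> \<open>c 1 = 0\<close> \<open>c 2 = 0\<close> i
      by (auto simp: numeral_2_eq_2 numeral_3_eq_3 less_Suc_eq)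
  qed
  show ?thesis
    unfolding functionally_independent_def
  proof (intro exI[of _ D] conjI ballI open_D subset dense allI impI)
    fix x c i
    assume "x \<in> D" and i: "i < length [?H, ?G, ?F]"
      and c: "\<forall>v. (\<Sum>i<length [?H, ?G, ?F]. c i * frechet_derivative ([?H, ?G, ?F] ! i) (at x) v) = 0"
    show "c i = 0" by (rule indep[OF \<open>x \<in> D\<close> spec[OF c] i])
  qed
qed

section \<open>The explicit integrals for an integer frequency\<close>

text \<open>The sign \<open>(- 1) ^ m\<close> turns powers of \<open>- D\<close> into the
  alternating signs of \<open>I_1\<close> and \<open>I_2\<close>. Passing from \<open>v\<close> to
  \<open>- v\<close> affects odd exponents only, where it cancels the minus sign of
  \<open>D_qpow_im_even\<close>.\<close>

lemma signed_qpow_even: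
  "(- 1) ^ m * qpow_re D u (- v) (2 * m) = (\<Sum>j=0..m. (- 1) ^ j * real ((2 * m) choose (2 * j)) *
     D ^ (m - j) * u ^ (2 * j) * v ^ (2 * m - 2 * j))" (is "_ = ?R")
  "(- 1) ^ m * (D * qpow_im D u (- v) (2 * m)) = (\<Sum>j=0..m. (- 1) ^ j * real ((2 * m) choose (2 * j)) *
     D ^ (m - j) * u ^ (2 * j) * (v ^ (2 * m - 2 * j - 1) * (2 * real (m - j) / real (2 * j + 1) * u)))" (is "_ = ?S")
proof -
  have sign: "(- 1) ^ m * (- D) ^ (m - j) = (- 1) ^ j * D ^ (m - j)" if j: "j \<le> m" for j
  proof -
    from le_Suc_ex[OF j] obtain i where "m = j + i" ..
    moreover have "(- 1) ^ i * (- D) ^ i = D ^ i" by (simp flip: power_mult_distrib)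
    ultimately show ?thesis by (simp add: power_add mult.assoc)
  qed
  show "(- 1) ^ m * qpow_re D u (- v) (2 * m) = ?R"
    unfolding qpow_re_even sum_distrib_left
  proof (rule sum.cong)
    fix j assume "j \<in> {0..m}"
    then have j: "j \<le> m" by simp
    have "(- v) ^ (2 * m - 2 * j) = v ^ (2 * m - 2 * j)" by simp
    then have "(- 1) ^ m * (real (2 * m choose (2 * j)) * (- D) ^ (m - j) * (- v) ^ (2 * m - 2 * j) * u ^ (2 * j)) =
        ((- 1) ^ m * (- D) ^ (m - j)) * real (2 * m choose (2 * j)) * v ^ (2 * m - 2 * j) * u ^ (2 * j)"
      by (simp only: mult_ac)
    then show "(- 1) ^ m * (real (2 * m choose (2 * j)) * (- D) ^ (m - j) * (- v) ^ (2 * m - 2 * j) * u ^ (2 * j)) =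
        (- 1) ^ j * real ((2 * m) choose (2 * j)) * D ^ (m - j) * u ^ (2 * j) * v ^ (2 * m - 2 * j)"
      unfolding sign[OF j] by (simp only: mult_ac)
  qed simp
  show "(- 1) ^ m * (D * qpow_im D u (- v) (2 * m)) = ?S"
    unfolding D_qpow_im_even sum_negf[symmetric] sum_distrib_left
  proof (rule sum.cong)
    fix j assume "j \<in> {0..m}"
    then have j: "j \<le> m" by simp
    \<comment> \<open>For \<open>j = m\<close> the truncated exponent is 0 and thus even; there the
      factor \<open>real (m - j)\<close> makes both sides zero.\<close>
    have "(- v) ^ (2 * m - 2 * j - 1) * real (m - j) = - (v ^ (2 * m - 2 * j - 1) * real (m - j))"
    proof (cases "j = m")
      case False
      then have "odd (2 * m - 2 * j - 1)" using j by auto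
      then show ?thesis by simp
    qed simp
    moreover have "(- 1) ^ m * - (real (2 * m choose (2 * j)) * (- D) ^ (m - j) * (- v) ^ (2 * m - 2 * j - 1) *
          u ^ (2 * j) * (2 * real (m - j) / real (2 * j + 1) * u)) =
        - (((- 1) ^ m * (- D) ^ (m - j)) * real (2 * m choose (2 * j)) *
          ((- v) ^ (2 * m - 2 * j - 1) * real (m - j)) * u ^ (2 * j) * (2 / real (2 * j + 1) * u))"
      by simp
    ultimately show "(- 1) ^ m * - (real (2 * m choose (2 * j)) * (- D) ^ (m - j) * (- v) ^ (2 * m - 2 * j - 1) *
          u ^ (2 * j) * (2 * real (m - j) / real (2 * j + 1) * u)) =
        (- 1) ^ j * real ((2 * m) choose (2 * j)) * D ^ (m - j) * u ^ (2 * j) *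
          (v ^ (2 * m - 2 * j - 1) * (2 * real (m - j) / real (2 * j + 1) * u))"
      unfolding sign[OF j] by simp
  qed simp
qed

text \<open>For \<open>l = 1\<close> the conjugate of \<open>w\<close> enters linearly: in each
  summand \<open>w_re\<close> meets the even part of the radial power and \<open>w_im\<close> the
  odd part.\<close>

lemma I_2_eq_phase_re: "I_2 \<kappa> a b m = (\<lambda>x. (- 1) ^ m * phase_re \<kappa> a b (real m) (2 * m) 1 x)"
proof
  fix x :: point
  obtain r \<phi> p q where x: "x = (r, \<phi>, p, q)" by (cases x)
  define G where "G = angular_integral a b (real m) (r, \<phi>, p, q)"
  define A where "A = w_re a b (real m) (r, \<phi>, p, q)"
  define B where "B = w_im (real m) (r, \<phi>, p, q)"
  define T where "T = cot_kappa \<kappa> r"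
  have A: "A = G * cos (2 * real m * \<phi>) + b - a" by (simp add: A_def w_re_def G_def)
  have B: "B = q * sin (2 * real m * \<phi>) / 2" by (simp add: B_def w_im_def)
  have factor: "c * t * A + c * (u * z) * B = c * (t * A + u * y)" if "z * B = y" for c t u z y
    using that by (simp add: distrib_left mult.assoc)
  \<comment> \<open>The 2 of the odd binomial ratio cancels against the division by 2 in
    \<open>w_im\<close>.\<close>
  have half: "2 * t / u * p * B = t / u * p * q * sin (2 * real m * \<phi>)" for t u
    by (simp add: B)
  have "(- 1) ^ m * phase_re \<kappa> a b (real m) (2 * m) 1 x =
      ((- 1) ^ m * qpow_re (2 * G) p (- T) (2 * m)) * A + ((- 1) ^ m * (2 * G * qpow_im (2 * G) p (- T) (2 * m))) * B"
    unfolding phase_re_def Let_def x fst_conv snd_conv G_def[symmetric] A_def[symmetric] B_def[symmetric] T_def[symmetric]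
    by (simp add: algebra_simps)
  also have "\<dots> = I_2 \<kappa> a b m x"
    unfolding signed_qpow_even sum_distrib_right sum.distrib[symmetric] I_2_def x prod.case Let_def
      G_def[symmetric] T_def[unfolded cot_kappa_def, symmetric] A[symmetric]
    by (rule sum.cong[OF refl], rule factor, rule half)
  finally show "I_2 \<kappa> a b m x = (- 1) ^ m * phase_re \<kappa> a b (real m) (2 * m) 1 x" ..
qed

text \<open>The expansion of the odd part is that of \<open>D * qpow_im\<close>, with
  \<open>D\<close> twice the angular integral; hence this factor, which also absorbs the division by
  2 in \<open>w_im\<close>.\<close>

lemma I_1_eq_phase_im: "I_1 \<kappa> a b m =
  (\<lambda>x. (- 1) ^ m * (2 * angular_integral a b (real m) x * phase_im \<kappa> a b (real m) (2 * m) 1 x))"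
proof
  fix x :: point
  obtain r \<phi> p q where x: "x = (r, \<phi>, p, q)" by (cases x)
  define G where "G = angular_integral a b (real m) (r, \<phi>, p, q)"
  define A where "A = w_re a b (real m) (r, \<phi>, p, q)"
  define B where "B = w_im (real m) (r, \<phi>, p, q)"
  define T where "T = cot_kappa \<kappa> r"
  have A: "A = G * cos (2 * real m * \<phi>) + b - a" by (simp add: A_def w_re_def G_def)
  have B: "2 * G * B = G * q * sin (2 * real m * \<phi>)" by (simp add: B_def w_im_def)
  have "(- 1) ^ m * (2 * angular_integral a b (real m) x * phase_im \<kappa> a b (real m) (2 * m) 1 x) =
      ((- 1) ^ m * qpow_re (2 * G) p (- T) (2 * m)) * (2 * G * B) - ((- 1) ^ m * (2 * G * qpow_im (2 * G) p (- T) (2 * m))) * A"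
    unfolding phase_im_def Let_def x fst_conv snd_conv G_def[symmetric] A_def[symmetric] B_def[symmetric] T_def[symmetric]
    by (simp add: algebra_simps)
  also have "\<dots> = I_1 \<kappa> a b m x"
    unfolding signed_qpow_even sum_distrib_right sum_subtractf[symmetric] I_1_def x prod.case Let_def
      G_def[symmetric] T_def[unfolded cot_kappa_def, symmetric] A[symmetric] B[symmetric]
    by (rule sum.cong[OF refl]) (simp only: right_diff_distrib mult.assoc)
  finally show "I_1 \<kappa> a b m x =
      (- 1) ^ m * (2 * angular_integral a b (real m) x * phase_im \<kappa> a b (real m) (2 * m) 1 x)" ..
qed

lemma first_integral_I:
  fixes \<kappa> a b :: real and m :: nat
  defines "M \<equiv> phase_space \<kappa> (real m)" and "H \<equiv> hamiltonian \<kappa> a b (real m)"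
  shows "first_integral M H (I_1 \<kappa> a b m) \<and> polynomial_in_momenta M (I_1 \<kappa> a b m) \<and>
       first_integral M H (I_2 \<kappa> a b m) \<and> polynomial_in_momenta M (I_2 \<kappa> a b m)"
proof -
  have "phase_space_polynomial \<kappa> (real m) (I_1 \<kappa> a b m)" "phase_space_polynomial \<kappa> (real m) (I_2 \<kappa> a b m)"
    unfolding I_1_eq_phase_im I_2_eq_phase_re
    by (intro momentum_polynomial_intros phase_space_polynomial_phase phase_space_polynomial_angular_integral)+
  moreover
  \<comment> \<open>The resonance for \<open>k = 2 * m\<close> and \<open>l = 1\<close>.\<close>
  have freq: "0 = real 1 * (2 * real m * (1 / (S_kappa \<kappa> r)\<^sup>2)) - real (2 * m) * (1 / (S_kappa \<kappa> r)\<^sup>2)" for r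
    by simp
  have "first_integral M H (I_1 \<kappa> a b m)"
    unfolding M_def H_def
  proof (rule first_integral_hamiltonianI)
    fix r \<phi> p q assume M: "(r, \<phi>, p, q) \<in> phase_space \<kappa> (real m)"
    show "has_dir_deriv (I_1 \<kappa> a b m) (r, \<phi>, p, q) (1 * p, 1 / (S_kappa \<kappa> r)\<^sup>2 * q,
        1 * (2 * C_kappa \<kappa> r / (S_kappa \<kappa> r) ^ 3 * angular_integral a b (real m) (r, \<phi>, p, q)),
        - (1 / (S_kappa \<kappa> r)\<^sup>2 * potential_deriv a b (real m) \<phi>)) 0"
      unfolding I_1_eq_phase_im
      by (rule has_dir_deriv_eq[OF has_dir_deriv_mult[OF has_dir_deriv_const has_dir_deriv_mult[OF
              has_dir_deriv_mult[OF has_dir_deriv_const has_dir_deriv_w(1)[OF M refl]]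
              has_dir_deriv_phase(1)[OF M refl freq]]]]) simp
  qed (fact calculation)
  moreover have "first_integral M H (I_2 \<kappa> a b m)"
    unfolding M_def H_def
  proof (rule first_integral_hamiltonianI)
    fix r \<phi> p q assume M: "(r, \<phi>, p, q) \<in> phase_space \<kappa> (real m)"
    show "has_dir_deriv (I_2 \<kappa> a b m) (r, \<phi>, p, q) (1 * p, 1 / (S_kappa \<kappa> r)\<^sup>2 * q,
        1 * (2 * C_kappa \<kappa> r / (S_kappa \<kappa> r) ^ 3 * angular_integral a b (real m) (r, \<phi>, p, q)),
        - (1 / (S_kappa \<kappa> r)\<^sup>2 * potential_deriv a b (real m) \<phi>)) 0"
      unfolding I_2_eq_phase_re
      by (rule has_dir_deriv_eq[OF has_dir_deriv_mult[OF has_dir_deriv_const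
              has_dir_deriv_phase(2)[OF M refl freq]]]) simp
  qed (fact calculation)
  ultimately show ?thesis
    using momentum_polynomial_imp_polynomial_in_momenta by blast
qed

section \<open>Rational frequencies of either sign\<close>

text \<open>Sine and cosine enter only squared or through the vanishing of their product, so the
  sign of \<open>n\<close> is invisible. Passing to \<open>\<bar>n\<bar>\<close> allows the
  resonance to be solved by natural exponents.\<close>

lemma abs_frequency:
  "phase_space \<kappa> \<bar>n\<bar> = phase_space \<kappa> n" "hamiltonian \<kappa> a b \<bar>n\<bar> = hamiltonian \<kappa> a b n"
  "angular_integral a b \<bar>n\<bar> = angular_integral a b n"
  by (auto simp: abs_if phase_space_def hamiltonian_def angular_integral_def potential_def[abs_def])

theorem mainTheorem2:
  fixes \<kappa> a b n :: real
  assumes "n \<in> \<rat>" and "n \<noteq> 0"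
  defines "M \<equiv> phase_space \<kappa> n"
    and "H \<equiv> hamiltonian \<kappa> a b n"
    and "G \<equiv> angular_integral a b n"
  shows "first_integral M H H \<and> first_integral M H G \<and>
    maximally_superintegrable M H \<and>
    (\<exists>F. first_integral M H F \<and> polynomial_in_momenta M F \<and>
         functionally_independent M [H, G, F]) \<and>
    (\<forall>m::nat. m > 0 \<and> n = real m \<longrightarrow>
       first_integral M H (I_1 \<kappa> a b m) \<and> polynomial_in_momenta M (I_1 \<kappa> a b m) \<and>
       first_integral M H (I_2 \<kappa> a b m) \<and> polynomial_in_momenta M (I_2 \<kappa> a b m))"
proof -
  obtain m l :: nat where "l \<noteq> 0" "\<bar>n\<bar> = real m / real l"
    using Rats_abs_nat_div_natE[OF assms(1)] by metis
  \<comment> \<open>For the fraction \<open>m / l\<close> the exponents \<open>2 * m\<close> and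
    \<open>l\<close> are resonant; \<open>n \<noteq> 0\<close> makes the first one positive, as
    independence requires.\<close>
  then have kl: "real (2 * m) = 2 * \<bar>n\<bar> * real l" "2 * m > 0"
    using assms(2) by (auto intro!: Nat.gr0I)
  define F where "F = phase_im \<kappa> a b \<bar>n\<bar> (2 * m) l"
  have F: "first_integral M H F" "functionally_independent M [H, G, F]" "polynomial_in_momenta M F"
    using first_integral_phase_im[OF kl(1), of \<kappa> a b] functionally_independent_phase_im[OF kl, of \<kappa> a b]
      momentum_polynomial_imp_polynomial_in_momenta[OF phase_space_polynomial_phase(2)]
    unfolding F_def M_def H_def G_def abs_frequency by auto
  have HG: "first_integral M H H" "first_integral M H G"
    unfolding M_def H_def G_def
    by (rule first_integral_hamiltonian first_integral_angular_integral)+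
  \<comment> \<open>Reversing a bracket only changes its sign, so the integral property of
    \<open>G\<close> gives the commutation in this order.\<close>
  then have "poisson_commute M H G"
    unfolding first_integral_def poisson_commute_def by (subst poisson_antisym) simp
  then have "maximally_superintegrable M H"
    unfolding maximally_superintegrable_def using HG F by blast
  then show ?thesis
    using HG F first_integral_I unfolding M_def H_def by blast
qed

end
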